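(* Let $k,\Delta\in\mathbb{Z}_{\ge1}$. There is a function $f(k,\Delta)$ depending only on $k$ and $\Delta$ such that the following holds. Let $p,\ell,u\in\mathbb{Z}^n$, $A\in\mathbb{Z}^{m\times n}$ totally unimodular, $b\in\mathbb{Z}^m$, $W\in\mathbb{Z}^{k\times n}$ and $d\in\mathbb{Z}^k$ satisfy $\max\{\|Wx\|_\infty : x \text{ a circuit of } A\}\le\Delta$. Consider $$(\mathrm{IP}_1)\ \max\{p^\intercal x: Ax=b,\ Wx=d,\ \ell\le x\le u,\ x\in\mathbb{Z}^n\},\qquad (\mathrm{LP}_1)\ \max\{p^\intercal x: Ax=b,\ Wx=d,\ \ell\le x\le u\}.$$ If $x^*$ is an optimal solution of $(\mathrm{LP}_1)$ and $(\mathrm{IP}_1)$ is feasible, then there is an optimal solution $z^*$ of $(\mathrm{IP}_1)$ with $\|x^*-z^*\|_\infty\le f(k,\Delta)$.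
   Context: A circuit of a rational matrix $A$ is a nonzero integer vector in $\ker(A)$ with entries of gcd $1$ whose support is inclusion-wise minimal among supports of nonzero vectors of $\ker(A)$. A matrix is totally unimodular if every square subdeterminant is in $\{-1,0,1\}$. *)

theory Defs
  imports
    Complex_Main
    "Jordan_Normal_Form.Matrix_Kernel"
    "Jordan_Normal_Form.DL_Submatrix"
begin

definition vec_support :: "'a::zero vec \<Rightarrow> nat set" where
  "vec_support x = {i. i < dim_vec x \<and> x $ i \<noteq> 0}"

(* The inserted 0 only matters for the vector of dimension 0, whose norm is 0. *)
definition linf_norm :: "'a::linordered_idom vec \<Rightarrow> 'a" where
  "linf_norm x = Max (insert 0 {\<bar>x $ i\<bar> | i. i < dim_vec x})"

definition totally_unimodular :: "int mat \<Rightarrow> bool" where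
  "totally_unimodular A \<longleftrightarrow>
     (\<forall>I J. I \<subseteq> {..<dim_row A} \<longrightarrow> J \<subseteq> {..<dim_col A} \<longrightarrow> card I = card J \<longrightarrow>
        det (submatrix A I J) \<in> {-1, 0, 1})"

(* The kernel of the rational matrix A is taken in the real vector space. *)
definition circuit :: "rat mat \<Rightarrow> int vec \<Rightarrow> bool" where
  "circuit A x \<longleftrightarrow>
     (let K = mat_kernel (map_mat real_of_rat A) in
        map_vec real_of_int x \<in> K \<and>
        x \<noteq> 0\<^sub>v (dim_col A) \<and>
        Gcd {x $ i | i. i < dim_vec x} = 1 \<and>
        \<not> (\<exists>y\<in>K. y \<noteq> 0\<^sub>v (dim_col A) \<and> vec_support y \<subset> vec_support x))"

(* Used over int for the integer program and over real for its linear relaxation;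
   \<le> on vectors is componentwise. *)
definition feasible_set ::
  "'a::linordered_idom mat \<Rightarrow> 'a vec \<Rightarrow> 'a mat \<Rightarrow> 'a vec \<Rightarrow> 'a vec \<Rightarrow> 'a vec \<Rightarrow> 'a vec set" where
  "feasible_set A b W d l u =
     {x \<in> carrier_vec (dim_col A). A *\<^sub>v x = b \<and> W *\<^sub>v x = d \<and> l \<le> x \<and> x \<le> u}"

definition optimal_solution :: "'a::linordered_idom vec \<Rightarrow> 'a vec set \<Rightarrow> 'a vec \<Rightarrow> bool" where
  "optimal_solution p F x \<longleftrightarrow> is_arg_max (\<lambda>y. p \<bullet> y) (\<lambda>y. y \<in> F) x"

end

theory Submission
  imports Defs
begin

text \<open>
  Among the optimal solutions \<open>z\<close> of the integer program take one minimizing the sum of the integer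
  parts of \<open>\<bar>x\<^sub>e - z\<^sub>e\<bar>\<close>, where \<open>x\<close> is the given LP optimum, and put \<open>y = x - z\<close>. Then \<open>A y = 0\<close> and
  \<open>W y = 0\<close>. Rounding \<open>y\<close> inside the totally unimodular system yields an integral kernel vector
  between the floor and the ceiling of \<open>y\<close> whose \<open>W\<close>-value is at most \<open>k \<Delta>\<close>; it is a conformal sum
  of circuits, of which there are only boundedly many types according to their \<open>W\<close>-values. If \<open>\<bar>y\<^sub>j\<bar>\<close> is
  large, many circuits pass through \<open>j\<close>, and Dickson's lemma extracts a sub-sum \<open>v\<close> with \<open>W v = 0\<close>
  and \<open>v\<^sub>j \<noteq> 0\<close>. As \<open>x - \<epsilon> v\<close> is LP-feasible for small \<open>\<epsilon> > 0\<close>, the objective does not drop from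
  \<open>z\<close> to the feasible integral point \<open>z + v\<close>, which is closer to \<open>x\<close>: a contradiction.
\<close>

section \<open>Fractional kernel vectors of totally unimodular matrices\<close>

lemma bij_betw_pick:
  assumes "finite J"
  shows "bij_betw (pick J) {..<card J} J"
proof (rule bij_betw_imageI)
  show inj: "inj_on (pick J) {..<card J}"
    by (rule linorder_inj_onI') (use pick_mono_le[of _ J] in fastforce)
  have "pick J ` {..<card J} \<subseteq> J"
    using pick_in_set_le by auto
  then show "pick J ` {..<card J} = J"
    using assms inj by (simp add: card_image card_subset_eq)
qed

lemma submatrix_carrier_mat:
  assumes "I \<subseteq> {..<dim_row A}" "J \<subseteq> {..<dim_col A}"
  shows "submatrix A I J \<in> carrier_mat (card I) (card J)"
proof -
  have "{i. i < dim_row A \<and> i \<in> I} = I" "{j. j < dim_col A \<and> j \<in> J} = J"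
    using assms by auto
  then show ?thesis
    by (simp add: submatrix_def)
qed

lemma submatrix_index_subset:
  assumes "I \<subseteq> {..<dim_row A}" "J \<subseteq> {..<dim_col A}" "i < card I" "j < card J"
  shows "submatrix A I J $$ (i, j) = A $$ (pick I i, pick J j)"
proof -
  have "{i. i < dim_row A \<and> i \<in> I} = I" "{j. j < dim_col A \<and> j \<in> J} = J"
    using assms by auto
  then show ?thesis
    using assms by (simp add: submatrix_index)
qed

lemma sum_pick:
  assumes "finite J"
  shows "(\<Sum>k<card J. f (pick J k)) = (\<Sum>j\<in>J. f j)"
  using sum.reindex_bij_betw[OF bij_betw_pick[OF assms]] by simp

text \<open>The adjugate of the submatrix, relabelled by the elements of \<open>I\<close> and
  \<open>J\<close> in place of positions. It has entries in the same ring, so over the integers a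
  determinant of 1 or -1 yields an integral inverse.\<close>

lemma submatrix_adjugate:
  fixes A :: "'a::comm_ring_1 mat"
  assumes I: "I \<subseteq> {..<dim_row A}" and J: "J \<subseteq> {..<dim_col A}" and IJ: "card I = card J"
  shows "\<exists>B. (\<forall>j\<in>J. \<forall>j'\<in>J.
      (\<Sum>i\<in>I. B j i * A $$ (i, j')) = (if j = j' then det (submatrix A I J) else 0)) \<and>
    (\<forall>i\<in>I. \<forall>i'\<in>I.
      (\<Sum>j\<in>J. A $$ (i, j) * B j i') = (if i = i' then det (submatrix A I J) else 0))"
proof -
  let ?S = "submatrix A I J"
  let ?n = "card J"
  have fin: "finite I" "finite J"
    using I J finite_subset by blast+
  have S: "?S \<in> carrier_mat ?n ?n"
    using submatrix_carrier_mat[OF I J] IJ by simp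
  define T where "T = adj_mat ?S"
  note adj = adj_mat[OF S, folded T_def]
  have [simp]: "dim_row T = ?n" "dim_col T = ?n" "dim_row ?S = ?n" "dim_col ?S = ?n"
    using adj(1) S by auto
  \<comment> \<open>The number of smaller elements is the position of \<open>x\<close> in
    \<open>X\<close>, so \<open>idx X\<close> inverts \<open>pick X\<close>.\<close>
  define idx where "idx X x = card {a \<in> X. a < x}" for X :: "nat set" and x
  have idx: "idx X x < card X" "pick X (idx X x) = x" if "x \<in> X" "finite X" for X x
    using that by (auto simp: idx_def pick_card_in_set intro!: psubset_card_mono)
  have idx_inj: "idx X x = idx X y \<longleftrightarrow> x = y" if "x \<in> X" "y \<in> X" "finite X" for X x y
    using idx(2) that by metis
  have pick_idx: "idx X (pick X k) = k" if "k < card X" for X k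
    using that unfolding idx_def by (rule card_pick_le)
  define B where "B j i = T $$ (idx J j, idx I i)" for j i
  show ?thesis
  proof (intro exI[of _ B] conjI ballI)
    fix j j' assume j: "j \<in> J" "j' \<in> J"
    have "(\<Sum>i\<in>I. B j i * A $$ (i, j')) = (\<Sum>k<card I. B j (pick I k) * A $$ (pick I k, j'))"
      by (rule sum_pick[OF fin(1), symmetric])
    also have "\<dots> = (\<Sum>k<?n. T $$ (idx J j, k) * ?S $$ (k, idx J j'))"
      using IJ j fin idx by (intro sum.cong) (auto simp: B_def pick_idx submatrix_index_subset[OF I J])
    also have "\<dots> = (T * ?S) $$ (idx J j, idx J j')"
      using j fin idx by (simp add: times_mat_def scalar_prod_def atLeast0LessThan)
    also have "\<dots> = (if j = j' then det ?S else 0)"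
      unfolding adj(3) using j fin idx by (simp add: idx_inj)
    finally show "(\<Sum>i\<in>I. B j i * A $$ (i, j')) = (if j = j' then det ?S else 0)" .
  next
    fix i i' assume i: "i \<in> I" "i' \<in> I"
    then have idx_less: "idx I i < ?n" "idx I i' < ?n"
      using idx(1)[OF i(1) fin(1)] idx(1)[OF i(2) fin(1)] IJ by simp_all
    have "(\<Sum>j\<in>J. A $$ (i, j) * B j i') = (\<Sum>k<?n. A $$ (i, pick J k) * B (pick J k) i')"
      by (rule sum_pick[OF fin(2), symmetric])
    also have "\<dots> = (\<Sum>k<?n. ?S $$ (idx I i, k) * T $$ (k, idx I i'))"
      using idx_less IJ by (intro sum.cong) (simp_all add: B_def pick_idx submatrix_index_subset[OF I J] idx(2)[OF i(1) fin(1)])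
    also have "\<dots> = (?S * T) $$ (idx I i, idx I i')"
      using idx_less by (simp add: times_mat_def scalar_prod_def atLeast0LessThan)
    also have "\<dots> = (if i = i' then det ?S else 0)"
      unfolding adj(2) using i fin idx_less by (simp add: idx_inj)
    finally show "(\<Sum>j\<in>J. A $$ (i, j) * B j i') = (if i = i' then det ?S else 0)" .
  qed
qed

text \<open>A kernel vector over the field of reals, relabelled by \<open>J\<close>. It will show
  that a dependence among columns that holds on the rows of a maximal nonsingular submatrix also
  holds on each further row.\<close>

lemma singular_submatrix_kernel:
  fixes A :: "int mat"
  assumes I: "I \<subseteq> {..<dim_row A}" and J: "J \<subseteq> {..<dim_col A}" and IJ: "card I = card J"
    and det: "det (submatrix A I J) = 0"
  shows "\<exists>v :: nat \<Rightarrow> real. (\<exists>j\<in>J. v j \<noteq> 0) \<and> (\<forall>i\<in>I. (\<Sum>j\<in>J. of_int (A $$ (i, j)) * v j) = 0)"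
proof -
  let ?S = "submatrix A I J"
  let ?n = "card J"
  let ?R = "map_mat real_of_int ?S"
  have fin: "finite I" "finite J"
    using I J finite_subset by blast+
  have S: "?S \<in> carrier_mat ?n ?n"
    using submatrix_carrier_mat[OF I J] IJ by simp
  have "det ?R = 0"
    using det by simp
  then obtain w where w: "w \<in> carrier_vec ?n" "w \<noteq> 0\<^sub>v ?n" "?R *\<^sub>v w = 0\<^sub>v ?n"
    using det_0_iff_vec_prod_zero_field[of ?R ?n] S by auto
  define idx where "idx x = card {a \<in> J. a < x}" for x
  have pick_idx: "idx (pick J k) = k" if "k < card J" for k
    using that unfolding idx_def by (rule card_pick_le)
  define v where "v j = w $ idx j" for j
  from w(1,2) obtain k where k: "k < ?n" "w $ k \<noteq> 0"
    by (metis carrier_vecD eq_vecI index_zero_vec)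
  show ?thesis
  proof (intro exI[of _ v] conjI ballI)
    have "pick J k \<in> J"
      using k pick_in_set_le by blast
    moreover have "v (pick J k) \<noteq> 0"
      using k by (simp add: v_def pick_idx)
    ultimately show "\<exists>j\<in>J. v j \<noteq> 0"
      by blast
    fix i assume i: "i \<in> I"
    define a where "a = card {x \<in> I. x < i}"
    have a: "a < card I" "pick I a = i"
      using i fin by (auto simp: a_def pick_card_in_set intro!: psubset_card_mono)
    have "(\<Sum>j\<in>J. of_int (A $$ (i, j)) * v j) = (\<Sum>k<?n. of_int (A $$ (i, pick J k)) * v (pick J k))"
      by (rule sum_pick[OF fin(2), symmetric])
    also have "\<dots> = (\<Sum>k<?n. ?R $$ (a, k) * w $ k)"
      using a IJ S by (intro sum.cong) (auto simp: v_def pick_idx submatrix_index_subset[OF I J])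
    also have "\<dots> = (?R *\<^sub>v w) $ a"
      using a IJ S w(1) by (simp add: scalar_prod_def atLeast0LessThan)
    also have "\<dots> = 0"
      using a IJ by (simp add: w(3))
    finally show "(\<Sum>j\<in>J. of_int (A $$ (i, j)) * v j) = 0" .
  qed
qed

text \<open>Take a nonsingular square submatrix of largest order within the fractional columns of
  \<open>z\<close>. Total unimodularity makes its inverse integral, so if it used all fractional
  columns, \<open>z\<close> would be integral on them. Hence some fractional column is left over. On
  the chosen rows it is a combination of the chosen columns, and maximality extends this dependence
  to all rows.\<close>

lemma totally_unimodular_fractional_kernel:
  fixes z :: "nat \<Rightarrow> real"
  assumes tu: "totally_unimodular A"
    and z: "\<And>i. i < dim_row A \<Longrightarrow> (\<Sum>j<dim_col A. of_int (A $$ (i, j)) * z j) = 0"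
    and j0: "j0 < dim_col A" "z j0 \<notin> \<int>"
  obtains v :: "nat \<Rightarrow> real" and f where "v f \<noteq> 0"
    "\<And>j. v j \<noteq> 0 \<Longrightarrow> j < dim_col A \<and> z j \<notin> \<int>"
    "\<And>i. i < dim_row A \<Longrightarrow> (\<Sum>j<dim_col A. of_int (A $$ (i, j)) * v j) = 0"
proof -
  define F where "F = {j. j < dim_col A \<and> z j \<notin> \<int>}"
  define P where "P c \<longleftrightarrow> (\<exists>I J. I \<subseteq> {..<dim_row A} \<and> J \<subseteq> F \<and> card I = c \<and> card J = c \<and>
    det (submatrix A I J) \<noteq> 0)" for c
  have F: "finite F" "F \<subseteq> {..<dim_col A}" "j0 \<in> F"
    using j0 by (auto simp: F_def)
  \<comment> \<open>The empty submatrix has determinant 1, so a largest order exists, possibly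
    0.\<close>
  have "submatrix A {} {} \<in> carrier_mat 0 0"
    using submatrix_carrier_mat[of "{}" A "{}"] by simp
  then have "det (submatrix A {} {}) = 1"
    by (rule det_dim_zero)
  then have "P 0"
    unfolding P_def by (intro exI[of _ "{}"]) simp
  have P_le: "c \<le> card F" if "P c" for c
  proof -
    from that obtain J where "J \<subseteq> F" "card J = c"
      unfolding P_def by blast
    then show ?thesis
      using card_mono[OF F(1)] by blast
  qed
  define c where "c = (GREATEST c. P c)"
  have "P c"
    unfolding c_def by (rule GreatestI_nat[of P, OF \<open>P 0\<close> P_le])
  have max: "c' \<le> c" if "P c'" for c'
    unfolding c_def by (rule Greatest_le_nat[of P, OF that P_le])
  from \<open>P c\<close> obtain I J where I: "I \<subseteq> {..<dim_row A}" and J: "J \<subseteq> F" and cards: "card I = c" "card J = c"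
    and det: "det (submatrix A I J) \<noteq> 0"
    by (auto simp: P_def)
  have J': "J \<subseteq> {..<dim_col A}"
    using J F by blast
  have fin: "finite I" "finite J"
    using I J' finite_subset by blast+
  have IJ: "card I = card J"
    using cards by simp
  define d where "d = det (submatrix A I J)"
  have "d \<in> {-1, 0, 1}"
    using tu I J' cards unfolding totally_unimodular_def d_def by metis
  then have dd: "real_of_int d * real_of_int d = 1"
    using det by (auto simp: d_def)
  obtain B where
    BA: "\<forall>j\<in>J. \<forall>j'\<in>J. (\<Sum>i\<in>I. B j i * A $$ (i, j')) = (if j = j' then d else 0)" and
    AB: "\<forall>i\<in>I. \<forall>i'\<in>I. (\<Sum>j\<in>J. A $$ (i, j) * B j i') = (if i = i' then d else 0)"
    using submatrix_adjugate[OF I J' IJ, folded d_def] by blast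
  have BAx: "(\<Sum>i\<in>I. of_int (B j i) * (\<Sum>j'\<in>J. of_int (A $$ (i, j')) * x j')) = of_int d * x j"
    if "j \<in> J" for j and x :: "nat \<Rightarrow> real"
  proof -
    have "(\<Sum>i\<in>I. of_int (B j i) * (\<Sum>j'\<in>J. of_int (A $$ (i, j')) * x j')) =
        (\<Sum>j'\<in>J. of_int (\<Sum>i\<in>I. B j i * A $$ (i, j')) * x j')"
      by (simp add: sum_distrib_left sum_distrib_right sum.swap[of _ J] mult.assoc)
    also have "\<dots> = (\<Sum>j'\<in>J. if j = j' then of_int d * x j' else 0)"
      using that by (intro sum.cong) (auto simp: BA)
    finally show ?thesis
      using that fin by simp
  qed
  have ABx: "(\<Sum>j\<in>J. of_int (A $$ (i, j)) * (\<Sum>i'\<in>I. of_int (B j i') * y i')) = of_int d * y i"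
    if "i \<in> I" for i and y :: "nat \<Rightarrow> real"
  proof -
    have "(\<Sum>j\<in>J. of_int (A $$ (i, j)) * (\<Sum>i'\<in>I. of_int (B j i') * y i')) =
        (\<Sum>i'\<in>I. of_int (\<Sum>j\<in>J. A $$ (i, j) * B j i') * y i')"
      by (simp add: sum_distrib_left sum_distrib_right sum.swap[of _ I] mult.assoc)
    also have "\<dots> = (\<Sum>i'\<in>I. if i = i' then of_int d * y i' else 0)"
      using that by (intro sum.cong) (auto simp: AB)
    finally show ?thesis
      using that fin by simp
  qed
  \<comment> \<open>If \<open>J = F\<close>, the columns outside \<open>F\<close> contribute
    integers to every row, so the right-hand side of the square system on \<open>I\<close> is
    integral and its integral inverse makes \<open>z j0\<close> an integer.\<close>
  have "J \<noteq> F"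
  proof
    assume "J = F"
    have "(\<Sum>j\<in>J. of_int (A $$ (i, j)) * z j) \<in> \<int>" if "i \<in> I" for i
    proof -
      have "(\<Sum>j<dim_col A. of_int (A $$ (i, j)) * z j) = (\<Sum>j\<in>{..<dim_col A} - F. of_int (A $$ (i, j)) * z j)
          + (\<Sum>j\<in>J. of_int (A $$ (i, j)) * z j)"
        unfolding \<open>J = F\<close> using F by (intro sum.subset_diff) auto
      then have "(\<Sum>j\<in>J. of_int (A $$ (i, j)) * z j) = - (\<Sum>j\<in>{..<dim_col A} - F. of_int (A $$ (i, j)) * z j)"
        using z[of i] that I by auto
      also have "\<dots> \<in> \<int>"
        by (intro Ints_minus Ints_sum Ints_mult) (auto simp: F_def)
      finally show ?thesis .
    qed
    then have "(\<Sum>i\<in>I. of_int (B j0 i) * (\<Sum>j'\<in>J. of_int (A $$ (i, j')) * z j')) \<in> \<int>"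
      by (intro Ints_sum) (simp add: Ints_mult)
    then have "of_int d * z j0 \<in> \<int>"
      using BAx[of j0 z] \<open>J = F\<close> F(3) by simp
    then have "of_int d * (of_int d * z j0) \<in> \<int>"
      by (rule Ints_mult[OF Ints_of_int])
    then show False
      using dd j0 by (simp add: mult.assoc[symmetric])
  qed
  then obtain f where f: "f \<in> F" "f \<notin> J"
    using J by blast
  \<comment> \<open>As \<open>d * d = 1\<close>, the inverse of the submatrix is
    \<open>d * B\<close>. The entries on \<open>J\<close> are thus the solution of the rows in
    \<open>I\<close> once the entry at \<open>f\<close> is set to 1.\<close>
  define v :: "nat \<Rightarrow> real" where "v j = (if j = f then 1 else if j \<in> J then
    - of_int d * (\<Sum>i\<in>I. of_int (B j i) * of_int (A $$ (i, f))) else 0)" for j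
  have vJ: "(\<Sum>j\<in>insert f J. of_int (A $$ (i, j)) * v j) = 0" if "i \<in> I" for i
  proof -
    have "(\<Sum>j\<in>J. of_int (A $$ (i, j)) * v j) =
        - of_int d * (\<Sum>j\<in>J. of_int (A $$ (i, j)) * (\<Sum>i'\<in>I. of_int (B j i') * of_int (A $$ (i', f))))"
      unfolding sum_distrib_left[of "- of_int d"] using f by (intro sum.cong) (auto simp: v_def mult.left_commute)
    also have "\<dots> = - of_int d * (of_int d * of_int (A $$ (i, f)))"
      using ABx[OF that, of "\<lambda>i. of_int (A $$ (i, f))"] by simp
    also have "\<dots> = - of_int (A $$ (i, f))"
      using dd by (simp add: mult.assoc[symmetric])
    finally show ?thesis
      using f fin by (simp add: v_def)
  qed
  have vrow: "(\<Sum>j\<in>insert f J. of_int (A $$ (i, j)) * v j) = 0" if i: "i < dim_row A" "i \<notin> I" for i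
  proof -
    have c: "card (insert i I) = Suc c" "card (insert f J) = Suc c"
      using fin cards i f by auto
    have "\<not> P (Suc c)"
      using max by fastforce
    have sub: "insert i I \<subseteq> {..<dim_row A}" "insert f J \<subseteq> F" "insert f J \<subseteq> {..<dim_col A}"
      using I J J' i f F(2) by auto
    have "det (submatrix A (insert i I) (insert f J)) = 0"
    proof (rule ccontr)
      assume "det (submatrix A (insert i I) (insert f J)) \<noteq> 0"
      with sub c have "P (Suc c)"
        unfolding P_def by (intro exI[of _ "insert i I"] exI[of _ "insert f J"]) simp
      with \<open>\<not> P (Suc c)\<close> show False
        by contradiction
    qed
    then obtain u :: "nat \<Rightarrow> real" and e where u: "e \<in> insert f J" "u e \<noteq> 0"
        "\<And>i'. i' \<in> insert i I \<Longrightarrow> (\<Sum>j\<in>insert f J. of_int (A $$ (i', j)) * u j) = 0"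
      using singular_submatrix_kernel[OF sub(1,3)] c by auto
    \<comment> \<open>This difference vanishes at \<open>f\<close> and satisfies the rows in
      \<open>I\<close>, so nonsingularity forces it to vanish on \<open>J\<close> as well. Hence
      \<open>u\<close> is a nonzero multiple of \<open>v\<close> there, and \<open>v\<close>
      inherits row \<open>i\<close>.\<close>
    define x where "x j = u j - u f * v j" for j
    have "x f = 0"
      by (simp add: x_def v_def)
    have "(\<Sum>j\<in>J. of_int (A $$ (i', j)) * x j) = 0" if "i' \<in> I" for i'
    proof -
      have "(\<Sum>j\<in>insert f J. of_int (A $$ (i', j)) * x j) = (\<Sum>j\<in>insert f J. of_int (A $$ (i', j)) * u j)
          - u f * (\<Sum>j\<in>insert f J. of_int (A $$ (i', j)) * v j)"
        by (simp only: x_def right_diff_distrib sum_subtractf sum_distrib_left mult.left_commute)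
      then have "(\<Sum>j\<in>insert f J. of_int (A $$ (i', j)) * x j) = 0"
        using u(3) vJ that by simp
      then show ?thesis
        using f fin \<open>x f = 0\<close> by simp
    qed
    then have "of_int d * x j = 0" if "j \<in> J" for j
      using BAx[OF that, of x] by simp
    moreover have "d \<noteq> 0"
      using dd by auto
    ultimately have x0: "x j = 0" if "j \<in> insert f J" for j
      using that \<open>x f = 0\<close> by auto
    have uv: "u j = u f * v j" if "j \<in> insert f J" for j
      using x0[OF that] by (simp add: x_def)
    have "u f \<noteq> 0"
      using u(2) uv[OF u(1)] by auto
    have "0 = (\<Sum>j\<in>insert f J. of_int (A $$ (i, j)) * u j)"
      using u(3)[of i] by simp
    also have "\<dots> = (\<Sum>j\<in>insert f J. of_int (A $$ (i, j)) * (u f * v j))"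
      by (intro sum.cong refl arg_cong2[where f = "(*)"] uv)
    also have "\<dots> = u f * (\<Sum>j\<in>insert f J. of_int (A $$ (i, j)) * v j)"
      by (simp only: sum_distrib_left mult.left_commute)
    finally show ?thesis
      using \<open>u f \<noteq> 0\<close> by simp
  qed
  show ?thesis
  proof (rule that[of v f])
    show "v f \<noteq> 0"
      by (simp add: v_def)
    show "j < dim_col A \<and> z j \<notin> \<int>" if "v j \<noteq> 0" for j
      using that f J by (auto simp: v_def F_def split: if_splits)
    fix i assume i: "i < dim_row A"
    have "(\<Sum>j<dim_col A. of_int (A $$ (i, j)) * v j) = (\<Sum>j\<in>insert f J. of_int (A $$ (i, j)) * v j)"
      using f F J' by (intro sum.mono_neutral_right) (auto simp: v_def)
    then show "(\<Sum>j<dim_col A. of_int (A $$ (i, j)) * v j) = 0"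
      using vJ vrow i by (cases "i \<in> I") simp_all
  qed
qed

section \<open>Elementary vectors of a unimodular space\<close>

definition fractional :: "('a \<Rightarrow> real) \<Rightarrow> 'a set" where
  "fractional z = {e. z e \<notin> \<int>}"

definition nonzeros :: "('a \<Rightarrow> real) \<Rightarrow> 'a set" where
  "nonzeros x = {e. x e \<noteq> 0}"

text \<open>The product expresses agreement of signs. Containment of supports is a separate
  condition because the product is also 0 where only \<open>y\<close> vanishes.\<close>

definition conformal :: "('a \<Rightarrow> real) \<Rightarrow> ('a \<Rightarrow> real) \<Rightarrow> bool" where
  "conformal x y \<longleftrightarrow> (\<forall>e. 0 \<le> x e * y e \<and> (x e \<noteq> 0 \<longrightarrow> y e \<noteq> 0))"

lemma conformal_refl: "conformal x x"
  by (simp add: conformal_def)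

lemma conformal_trans:
  assumes "conformal x y" "conformal y z"
  shows "conformal x z"
  unfolding conformal_def
proof
  fix e
  show "0 \<le> x e * z e \<and> (x e \<noteq> 0 \<longrightarrow> z e \<noteq> 0)"
    using assms[unfolded conformal_def, rule_format, of e] by (auto simp: zero_le_mult_iff)
qed

lemma conformal_nonzeros: "conformal x y \<Longrightarrow> nonzeros x \<subseteq> nonzeros y"
  by (auto simp: conformal_def nonzeros_def)

text \<open>Abstracts the real kernel of a totally unimodular matrix: a subspace of functions
  supported on a finite set, where unimodularity survives only as
  \<open>fractional_direction\<close>.\<close>

locale unimodular_space =
  fixes E :: "'a set" and K :: "('a \<Rightarrow> real) set"
  assumes finite_E: "finite E"
    and zero_in_K: "(\<lambda>_. 0) \<in> K"
    and K_add_scaled: "\<And>x y t. x \<in> K \<Longrightarrow> y \<in> K \<Longrightarrow> (\<lambda>e. x e + t * y e) \<in> K"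
    and nonzeros_E: "\<And>x. x \<in> K \<Longrightarrow> nonzeros x \<subseteq> E"
    and fractional_direction: "\<And>z. z \<in> K \<Longrightarrow> fractional z \<noteq> {} \<Longrightarrow>
      \<exists>v\<in>K. nonzeros v \<noteq> {} \<and> nonzeros v \<subseteq> fractional z"
begin

text \<open>The circuits of \<open>K\<close>, with the entries that unimodularity will be shown to
  allow built in.\<close>

definition elementary :: "('a \<Rightarrow> real) \<Rightarrow> bool" where
  "elementary c \<longleftrightarrow> c \<in> K \<and> nonzeros c \<noteq> {} \<and>
    (\<forall>v\<in>K. nonzeros v \<subset> nonzeros c \<longrightarrow> nonzeros v = {}) \<and> (\<forall>e. c e \<in> {-1, 0, 1})"

section \<open>Conformal decomposition into elementary vectors\<close>

lemma finite_nonzeros: "x \<in> K \<Longrightarrow> finite (nonzeros x)"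
  using nonzeros_E finite_E finite_subset by blast

lemma fractional_subset_nonzeros: "fractional x \<subseteq> nonzeros x"
  by (auto simp: fractional_def nonzeros_def)

lemma K_scaled: "y \<in> K \<Longrightarrow> (\<lambda>e. t * y e) \<in> K"
  using K_add_scaled[OF zero_in_K, of y t] by simp

lemma K_diff: "x \<in> K \<Longrightarrow> y \<in> K \<Longrightarrow> (\<lambda>e. x e - y e) \<in> K"
  using K_add_scaled[of x y "-1"] by simp

text \<open>Take a nonzero vector conformal to \<open>x\<close> with fewest nonzero entries. A
  nonzero kernel vector of strictly smaller support could be added with the multiple given by a
  ratio test, cancelling an entry without reversing any sign.\<close>

lemma exists_minimal_conformal:
  assumes "x \<in> K" "nonzeros x \<noteq> {}"
  obtains y where "y \<in> K" "nonzeros y \<noteq> {}" "conformal y x"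
    "\<And>v. v \<in> K \<Longrightarrow> nonzeros v \<subset> nonzeros y \<Longrightarrow> nonzeros v = {}"
proof -
  define Q where "Q y \<longleftrightarrow> y \<in> K \<and> nonzeros y \<noteq> {} \<and> conformal y x" for y
  have "Q x"
    using assms by (simp add: Q_def conformal_refl)
  then obtain y where y: "Q y" and min: "\<And>y'. Q y' \<Longrightarrow> card (nonzeros y) \<le> card (nonzeros y')"
    using ex_has_least_nat[of Q x "\<lambda>y. card (nonzeros y)"] by blast
  have "nonzeros v = {}" if v: "v \<in> K" "nonzeros v \<subset> nonzeros y" for v
  proof (rule ccontr)
    assume "nonzeros v \<noteq> {}"
    define e0 where "e0 = arg_min_on (\<lambda>e. \<bar>y e / v e\<bar>) (nonzeros v)"
    note e0_arg_min = arg_min_if_finite[OF finite_nonzeros[OF v(1)] \<open>nonzeros v \<noteq> {}\<close>,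
        of "\<lambda>e. \<bar>y e / v e\<bar>", folded e0_def]
    have e0: "e0 \<in> nonzeros v"
      by (rule e0_arg_min(1))
    have e0_min: "\<bar>y e0 / v e0\<bar> \<le> \<bar>y e / v e\<bar>" if "e \<in> nonzeros v" for e
      using e0_arg_min(2) that by (auto simp: not_less)
    define t where "t = - (y e0 / v e0)"
    define w where "w e = y e + t * v e" for e
    have bound: "\<bar>t * v e\<bar> \<le> \<bar>y e\<bar>" for e
      using e0_min[of e] by (cases "v e = 0") (auto simp: t_def nonzeros_def abs_mult abs_divide field_simps)
    have w0: "w e0 = 0"
      using e0 by (simp add: w_def t_def nonzeros_def)
    have sub: "nonzeros w \<subseteq> nonzeros y"
      using v(2) by (auto simp: nonzeros_def w_def)
    have "nonzeros w \<subset> nonzeros y"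
      using sub w0 e0 v(2) by (auto simp: nonzeros_def)
    then have "card (nonzeros w) < card (nonzeros y)"
      using finite_nonzeros y by (simp add: Q_def psubset_card_mono)
    moreover have "Q w"
      unfolding Q_def
    proof (intro conjI)
      show "w \<in> K"
        using K_add_scaled[of y v t] y v(1) by (simp add: w_def[abs_def] Q_def)
      \<comment> \<open>Properness of the inclusion of supports keeps \<open>w\<close> nonzero:
        \<open>w\<close> agrees with \<open>y\<close> outside the support of
        \<open>v\<close>.\<close>
      obtain e where "e \<in> nonzeros y" "e \<notin> nonzeros v"
        using v(2) by blast
      then have "e \<in> nonzeros w"
        by (simp add: nonzeros_def w_def)
      then show "nonzeros w \<noteq> {}"
        by blast
      have "0 \<le> w e * y e" for e
        using bound[of e] unfolding w_def by (cases "0 \<le> y e") (auto simp: zero_le_mult_iff)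
      then have "conformal w y"
        using sub by (auto simp: conformal_def nonzeros_def)
      then show "conformal w x"
        using y conformal_trans by (auto simp: Q_def)
    qed
    ultimately show False
      using min by fastforce
  qed
  then show ?thesis
    using y that by (auto simp: Q_def)
qed

text \<open>Scaling a support-minimal vector so that one entry is 1 makes all entries integral, since a
  fractional entry would produce a kernel vector of smaller support. As this works for every entry
  of the support, all ratios of entries are units.\<close>

lemma minimal_ratio_integral:
  assumes y: "y \<in> K" "\<And>v. v \<in> K \<Longrightarrow> nonzeros v \<subset> nonzeros y \<Longrightarrow> nonzeros v = {}"
    and e: "e0 \<in> nonzeros y"
  shows "y e / y e0 \<in> \<int>"
proof (rule ccontr)
  assume not_int: "y e / y e0 \<notin> \<int>"
  define z where "z e = y e / y e0" for e
  have "z \<in> K"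
    using K_scaled[OF y(1), of "1 / y e0"] by (simp add: z_def[abs_def])
  moreover have "fractional z \<noteq> {}"
    using not_int by (auto simp: fractional_def z_def)
  ultimately obtain v where v: "v \<in> K" "nonzeros v \<noteq> {}" "nonzeros v \<subseteq> fractional z"
    using fractional_direction by blast
  moreover have "fractional z \<subseteq> nonzeros y - {e0}"
    using e by (auto simp: fractional_def nonzeros_def z_def)
  ultimately have "nonzeros v \<subset> nonzeros y" "nonzeros v \<noteq> {}"
    using e by auto
  then show False
    using y(2) v(1) by blast
qed

lemma exists_conformal_elementary:
  assumes "x \<in> K" "nonzeros x \<noteq> {}"
  obtains c where "elementary c" "conformal c x"
proof -
  obtain y where y: "y \<in> K" "nonzeros y \<noteq> {}" "conformal y x"
    "\<And>v. v \<in> K \<Longrightarrow> nonzeros v \<subset> nonzeros y \<Longrightarrow> nonzeros v = {}"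
    using exists_minimal_conformal[OF assms] by metis
  then obtain e0 where e0: "e0 \<in> nonzeros y"
    by blast
  have abs_eq: "\<bar>y e\<bar> = \<bar>y e0\<bar>" if e: "e \<in> nonzeros y" for e
  proof -
    have "1 \<le> \<bar>y a / y b\<bar>" if "a \<in> nonzeros y" "b \<in> nonzeros y" for a b
      using minimal_ratio_integral[OF y(1,4) that(2), of a] that
      by (intro Ints_nonzero_abs_ge1) (auto simp: nonzeros_def)
    from this[OF e e0] this[OF e0 e] show ?thesis
      using e e0 by (simp add: nonzeros_def abs_divide field_simps)
  qed
  \<comment> \<open>Dividing by the absolute value and not by the entry itself keeps all signs,
    hence conformality.\<close>
  define c where "c e = (1 / \<bar>y e0\<bar>) * y e" for e
  have nz: "nonzeros c = nonzeros y"
    using e0 by (auto simp: nonzeros_def c_def)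
  have "c \<in> K"
    using K_scaled y(1) unfolding c_def[abs_def] by blast
  moreover have "c e \<in> {-1, 0, 1}" for e
    using abs_eq[of e] e0 by (cases "y e = 0") (auto simp: nonzeros_def c_def abs_if field_simps split: if_splits)
  ultimately have "elementary c"
    using y nz by (simp add: elementary_def)
  moreover have "conformal c x"
    using y(3) nz by (auto simp: conformal_def c_def)
  ultimately show ?thesis
    using that by blast
qed

lemma elementary_values: "elementary c \<Longrightarrow> c e = -1 \<or> c e = 0 \<or> c e = 1"
  by (auto simp: elementary_def)

text \<open>Induction on the 1-norm: subtracting a conformal elementary vector \<open>c\<close>
  lowers it by at least 1. Where \<open>c\<close> is nonzero, \<open>x\<close> is a nonzero integer
  and so at least 1 in absolute value; the remainder therefore stays conformal to \<open>x\<close>,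
  and so do the later summands. A list permits repeated summands.\<close>

lemma integral_decomposition:
  assumes "x \<in> K" "fractional x = {}"
  shows "\<exists>cs. (\<forall>c\<in>set cs. elementary c \<and> conformal c x) \<and> x = (\<lambda>e. \<Sum>c\<leftarrow>cs. c e)"
  using assms
proof (induction "nat \<lfloor>\<Sum>e\<in>E. \<bar>x e\<bar>\<rfloor>" arbitrary: x rule: less_induct)
  case less
  show ?case
  proof (cases "nonzeros x = {}")
    case True
    then show ?thesis
      by (intro exI[of _ "[]"]) (auto simp: nonzeros_def)
  next
    case False
    obtain c where c: "elementary c" "conformal c x"
      using exists_conformal_elementary[OF less.prems(1) False] by blast
    define w where "w e = x e - c e" for e
    have cK: "c \<in> K"
      using c by (auto simp: elementary_def)
    note c_vals = elementary_values[OF c(1)]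
    have x_int: "x e \<in> \<int>" for e
      using less.prems(2) by (auto simp: fractional_def)
    have x_ge: "1 \<le> \<bar>x e\<bar>" if "c e \<noteq> 0" for e
      using that c(2) x_int by (intro Ints_nonzero_abs_ge1) (auto simp: conformal_def)
    have c_sgn: "0 \<le> c e * x e" for e
      using c(2) by (simp add: conformal_def)
    have abs_x: "\<bar>x e\<bar> = \<bar>w e\<bar> + \<bar>c e\<bar>" for e
      using c_vals[of e] c_sgn[of e] x_ge[of e] by (auto simp: w_def)
    have wx: "conformal w x"
      unfolding conformal_def
    proof
      fix e
      show "0 \<le> w e * x e \<and> (w e \<noteq> 0 \<longrightarrow> x e \<noteq> 0)"
        using c_vals[of e] c_sgn[of e] x_ge[of e] by (auto simp: w_def zero_le_mult_iff)
    qed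
    obtain f where f: "f \<in> nonzeros c"
      using c(1) by (auto simp: elementary_def)
    have fE: "f \<in> E"
      using f nonzeros_E[OF cK] by blast
    have w_int: "w e \<in> \<int>" for e
      using x_int c_vals[of e] unfolding w_def by (intro Ints_diff) auto
    have "(\<Sum>e\<in>E. \<bar>x e\<bar>) = (\<Sum>e\<in>E. \<bar>w e\<bar>) + (\<Sum>e\<in>E. \<bar>c e\<bar>)"
      by (simp add: abs_x sum.distrib)
    moreover have "1 \<le> (\<Sum>e\<in>E. \<bar>c e\<bar>)"
      using member_le_sum[OF fE, of "\<lambda>e. \<bar>c e\<bar>"] finite_E f c_vals[of f] by (auto simp: nonzeros_def)
    moreover have "0 \<le> (\<Sum>e\<in>E. \<bar>w e\<bar>)"
      by (simp add: sum_nonneg)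
    ultimately have "nat \<lfloor>\<Sum>e\<in>E. \<bar>w e\<bar>\<rfloor> < nat \<lfloor>\<Sum>e\<in>E. \<bar>x e\<bar>\<rfloor>"
      by linarith
    moreover have "w \<in> K"
      using K_diff less.prems(1) cK by (auto simp: w_def[abs_def])
    moreover have "fractional w = {}"
      using w_int by (simp add: fractional_def)
    ultimately obtain cs where cs: "\<forall>c\<in>set cs. elementary c \<and> conformal c w"
        "w = (\<lambda>e. \<Sum>c\<leftarrow>cs. c e)"
      using less.hyps[of w] by blast
    have "x = (\<lambda>e. \<Sum>c\<leftarrow>c # cs. c e)"
    proof
      fix e
      show "x e = (\<Sum>c\<leftarrow>c # cs. c e)"
        using fun_cong[OF cs(2), of e] by (simp add: w_def)
    qed
    moreover have "\<forall>c'\<in>set (c # cs). elementary c' \<and> conformal c' x"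
      using cs(1) c conformal_trans[OF _ wx] by auto
    ultimately show ?thesis
      by blast
  qed
qed

text \<open>Stop at the first moment when an entry in the support of \<open>v\<close> becomes
  integral. Until then each entry stays between its floor and ceiling, and entries integral at the
  start do not move. The last bound will give \<open>t \<le> 1\<close> when \<open>v\<close> is
  elementary.\<close>

lemma move_to_integral:
  assumes "z \<in> K" "v \<in> K" "nonzeros v \<noteq> {}" "nonzeros v \<subseteq> fractional z"
  obtains t f where "0 \<le> t" "f \<in> nonzeros v" "fractional (\<lambda>e. z e + t * v e) \<subseteq> fractional z - {f}"
    "\<And>e. of_int \<lfloor>z e\<rfloor> \<le> z e + t * v e" "\<And>e. z e + t * v e \<le> of_int \<lceil>z e\<rceil>"
    "t * \<bar>v f\<bar> \<le> 1"
proof -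
  \<comment> \<open>The time at which entry \<open>e\<close> reaches the next integer in the
    direction of \<open>v e\<close>; minimized over the support of \<open>v\<close> only.\<close>
  define h where "h e = (if 0 < v e then (of_int \<lceil>z e\<rceil> - z e) / v e else (of_int \<lfloor>z e\<rfloor> - z e) / v e)" for e
  define f where "f = arg_min_on h (nonzeros v)"
  note f_arg_min = arg_min_if_finite[OF finite_nonzeros[OF assms(2)] assms(3), of h, folded f_def]
  have f: "f \<in> nonzeros v"
    by (rule f_arg_min(1))
  have f_min: "h f \<le> h e" if "e \<in> nonzeros v" for e
    using f_arg_min(2) that by (auto simp: not_less)
  have h_nonneg: "0 \<le> h e" for e
    by (auto simp: h_def intro: divide_nonneg_nonneg divide_nonpos_nonpos)
  have hf: "z f + h f * v f \<in> \<int>"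
    using f by (auto simp: h_def nonzeros_def)
  have bounds: "of_int \<lfloor>z e\<rfloor> \<le> z e + h f * v e \<and> z e + h f * v e \<le> of_int \<lceil>z e\<rceil>" for e
  proof (cases "v e = 0")
    case False
    then have "h f \<le> h e"
      using f_min by (simp add: nonzeros_def)
    consider "0 < v e" | "v e < 0"
      using False by linarith
    then show ?thesis
    proof cases
      case 1
      then have "h f * v e \<le> of_int \<lceil>z e\<rceil> - z e"
        using \<open>h f \<le> h e\<close> by (simp add: h_def field_simps)
      moreover have "0 \<le> h f * v e"
        using 1 h_nonneg by simp
      ultimately show ?thesis
        by linarith
    next
      case 2
      then have "of_int \<lfloor>z e\<rfloor> - z e \<le> h f * v e"
        using \<open>h f \<le> h e\<close> by (simp add: h_def field_simps)
      moreover have "h f * v e \<le> 0"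
        using 2 h_nonneg by (simp add: mult_nonneg_nonpos)
      ultimately show ?thesis
        by linarith
    qed
  qed simp
  show ?thesis
  proof (rule that[of "h f" f])
    show "fractional (\<lambda>e. z e + h f * v e) \<subseteq> fractional z - {f}"
    proof
      fix e assume "e \<in> fractional (\<lambda>e. z e + h f * v e)"
      then show "e \<in> fractional z - {f}"
        using hf assms(4) by (cases "v e = 0") (auto simp: fractional_def nonzeros_def)
    qed
    have "h f * \<bar>v f\<bar> = \<bar>(z f + h f * v f) - z f\<bar>"
      using h_nonneg[of f] by (simp add: abs_mult)
    also have "\<dots> \<le> 1"
      using bounds[of f] by linarith
    finally show "h f * \<bar>v f\<bar> \<le> 1" .
  qed (use f h_nonneg bounds in auto)
qed

subsection \<open>Integral rounding\<close>

definition dot :: "('a \<Rightarrow> real) \<Rightarrow> ('a \<Rightarrow> real) \<Rightarrow> real" where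
  "dot w x = (\<Sum>e\<in>E. w e * x e)"

lemma dot_add_scaled: "dot w (\<lambda>e. x e + t * y e) = dot w x + t * dot w y"
  by (simp add: dot_def distrib_left sum.distrib sum_distrib_left mult.left_commute)

lemma dot_diff_scaled: "dot (\<lambda>e. w e - t * w' e) x = dot w x - t * dot w' x"
  by (simp add: dot_def left_diff_distrib sum_subtractf sum_distrib_left mult.assoc)

text \<open>The functionals indexed by \<open>I\<close> witness that the face of kernel directions supported on the
  fractional entries has dimension at most \<open>card I\<close>. Moving along one elementary vector until an
  entry becomes integral costs at most \<open>D\<close> and lowers this dimension.\<close>

lemma integral_rounding:
  assumes "finite I" "z \<in> K"
    and "\<And>x. x \<in> K \<Longrightarrow> nonzeros x \<subseteq> fractional z \<Longrightarrow> \<forall>i\<in>I. dot (\<phi> i) x = 0 \<Longrightarrow> nonzeros x = {}"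
  shows "\<exists>v\<in>K. fractional v = {} \<and> (\<forall>e. of_int \<lfloor>z e\<rfloor> \<le> v e \<and> v e \<le> of_int \<lceil>z e\<rceil>) \<and>
    (\<forall>w D. 0 \<le> D \<longrightarrow> (\<forall>c. elementary c \<longrightarrow> \<bar>dot w c\<bar> \<le> D) \<longrightarrow> \<bar>dot w v - dot w z\<bar> \<le> real (card I) * D)"
  using assms
proof (induction "card I" arbitrary: I \<phi> z rule: less_induct)
  case less
  show ?case
  proof (cases "fractional z = {}")
    case True
    then show ?thesis
      using less.prems(2) by (intro bexI[of _ z]) (auto intro: ceiling_correct)
  next
    case False
    then obtain v0 where v0: "v0 \<in> K" "nonzeros v0 \<noteq> {}" "nonzeros v0 \<subseteq> fractional z"
      using fractional_direction less.prems(2) by blast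
    then obtain c where c: "elementary c" "conformal c v0"
      using exists_conformal_elementary by blast
    have cK: "c \<in> K" and c_ne: "nonzeros c \<noteq> {}"
      using c(1) by (auto simp: elementary_def)
    have c_sub: "nonzeros c \<subseteq> fractional z"
      using conformal_nonzeros[OF c(2)] v0(3) by blast
    then obtain i where i: "i \<in> I" "dot (\<phi> i) c \<noteq> 0"
      using less.prems(3)[OF cK] c_ne by blast
    obtain t f where t: "0 \<le> t" "f \<in> nonzeros c"
      "fractional (\<lambda>e. z e + t * c e) \<subseteq> fractional z - {f}"
      "\<And>e. of_int \<lfloor>z e\<rfloor> \<le> z e + t * c e" "\<And>e. z e + t * c e \<le> of_int \<lceil>z e\<rceil>"
      "t * \<bar>c f\<bar> \<le> 1"
      using move_to_integral[OF less.prems(2) cK c_ne c_sub] by blast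
    have "t \<le> 1"
      using t(2,6) elementary_values[OF c(1), of f] by (auto simp: nonzeros_def)
    define z' where "z' e = z e + t * c e" for e
    have z'K: "z' \<in> K"
      using K_add_scaled[OF less.prems(2) cK] by (simp add: z'_def[abs_def])
    have frac_z': "fractional z' \<subseteq> fractional z - {f}"
      using t(3) by (simp add: z'_def[abs_def])
    \<comment> \<open>Gaussian elimination with pivot \<open>\<phi> i\<close>: every
      \<open>\<psi> j\<close> vanishes on \<open>c\<close>.\<close>
    define \<psi> where "\<psi> j e = \<phi> j e - (dot (\<phi> j) c / dot (\<phi> i) c) * \<phi> i e" for j e
    have card: "card (I - {i}) < card I"
      using less.prems(1) i(1) by (intro psubset_card_mono) auto
    have inj: "nonzeros x = {}" if x: "x \<in> K" "nonzeros x \<subseteq> fractional z'" "\<forall>j\<in>I - {i}. dot (\<psi> j) x = 0" for x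
    proof -
      \<comment> \<open>With this \<open>s\<close> all functionals \<open>\<phi> j\<close> vanish on
        \<open>x - s * c\<close>, so \<open>x = s * c\<close>. Since \<open>f\<close> is no longer
        fractional, \<open>x f = 0\<close> while \<open>c f\<close> is nonzero, which gives
        \<open>s = 0\<close>.\<close>
      define s where "s = dot (\<phi> i) x / dot (\<phi> i) c"
      define y where "y e = x e + (- s) * c e" for e
      have "y \<in> K"
        using K_add_scaled[OF x(1) cK, of "- s"] by (simp add: y_def[abs_def])
      moreover have "nonzeros y \<subseteq> fractional z"
      proof
        fix e assume "e \<in> nonzeros y"
        then have "e \<in> nonzeros x \<or> e \<in> nonzeros c"
          by (auto simp: y_def nonzeros_def)
        then show "e \<in> fractional z"
          using x(2) frac_z' c_sub by blast
      qed
      moreover have "dot (\<phi> j) y = 0" if "j \<in> I" for j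
      proof (cases "j = i")
        case True
        then show ?thesis
          using i(2) dot_add_scaled[of "\<phi> i" x "- s" c] by (simp add: y_def[abs_def] s_def)
      next
        case False
        then have "dot (\<psi> j) x = 0"
          using that x(3) by blast
        moreover have "dot (\<psi> j) x = dot (\<phi> j) x - (dot (\<phi> j) c / dot (\<phi> i) c) * dot (\<phi> i) x"
          unfolding \<psi>_def[abs_def] by (rule dot_diff_scaled)
        ultimately show ?thesis
          using dot_add_scaled[of "\<phi> j" x "- s" c] by (simp add: y_def[abs_def] s_def)
      qed
      ultimately have "nonzeros y = {}"
        using less.prems(3) by blast
      then have xs: "x e = s * c e" for e
        by (auto simp: nonzeros_def y_def)
      have "x f = 0"
        using x(2) frac_z' by (auto simp: nonzeros_def)
      then have "s = 0"
        using xs[of f] t(2) by (simp add: nonzeros_def)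
      then show ?thesis
        using xs by (simp add: nonzeros_def)
    qed
    have "\<exists>v\<in>K. fractional v = {} \<and> (\<forall>e. of_int \<lfloor>z' e\<rfloor> \<le> v e \<and> v e \<le> of_int \<lceil>z' e\<rceil>) \<and>
        (\<forall>w D. 0 \<le> D \<longrightarrow> (\<forall>c. elementary c \<longrightarrow> \<bar>dot w c\<bar> \<le> D) \<longrightarrow>
          \<bar>dot w v - dot w z'\<bar> \<le> real (card (I - {i})) * D)"
      by (rule less.hyps[where \<phi> = \<psi>, OF card finite_Diff[OF less.prems(1)] z'K]) (rule inj)
    then obtain v where v: "v \<in> K" "fractional v = {}" "\<forall>e. of_int \<lfloor>z' e\<rfloor> \<le> v e \<and> v e \<le> of_int \<lceil>z' e\<rceil>"
      "\<forall>w D. 0 \<le> D \<longrightarrow> (\<forall>c. elementary c \<longrightarrow> \<bar>dot w c\<bar> \<le> D) \<longrightarrow>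
        \<bar>dot w v - dot w z'\<bar> \<le> real (card (I - {i})) * D"
      by (elim bexE conjE) (rule that)
    show ?thesis
    proof (intro bexI[of _ v] conjI allI impI)
      show "of_int \<lfloor>z e\<rfloor> \<le> v e" for e
      proof -
        have "\<lfloor>z e\<rfloor> \<le> \<lfloor>z' e\<rfloor>"
          using t(4)[of e] by (simp add: z'_def le_floor_iff)
        then show ?thesis
          using v(3)[rule_format, of e] by linarith
      qed
      show "v e \<le> of_int \<lceil>z e\<rceil>" for e
      proof -
        have "\<lceil>z' e\<rceil> \<le> \<lceil>z e\<rceil>"
          using t(5)[of e] by (simp add: z'_def ceiling_le_iff)
        then show ?thesis
          using v(3)[rule_format, of e] by linarith
      qed
      fix w and D :: real assume D: "0 \<le> D" "\<forall>c. elementary c \<longrightarrow> \<bar>dot w c\<bar> \<le> D"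
      have "dot w z' = dot w z + t * dot w c"
        unfolding z'_def[abs_def] by (rule dot_add_scaled)
      moreover have "\<bar>t * dot w c\<bar> \<le> D"
      proof -
        have "\<bar>t * dot w c\<bar> \<le> 1 * D"
          unfolding abs_mult using D c(1) t(1) \<open>t \<le> 1\<close> by (intro mult_mono) auto
        then show ?thesis
          by simp
      qed
      moreover have "real (card I) * D = real (card (I - {i})) * D + D"
        unfolding card.remove[OF less.prems(1) i(1)] by (simp only: of_nat_Suc) (simp add: distrib_right)
      ultimately show "\<bar>dot w v - dot w z\<bar> \<le> real (card I) * D"
        using v(4)[THEN spec, THEN spec, THEN mp, OF D(1), THEN mp, OF D(2)] by linarith
    qed (use v in auto)
  qed
qed

text \<open>First pass to a point \<open>z\<close> with the fewest fractional entries among those in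
  the rounding box of \<open>y\<close> on which all \<open>W i\<close> vanish. A nonzero direction
  supported on its fractional entries and annihilated by every \<open>W i\<close> would make another
  entry integral, so the \<open>k\<close> functionals satisfy the hypothesis of
  \<open>integral_rounding\<close> at \<open>z\<close>.\<close>

lemma integral_rounding_bounded:
  assumes y: "y \<in> K" "\<forall>i<k. dot (W i) y = 0"
    and D: "0 \<le> D" "\<forall>i<k. \<forall>c. elementary c \<longrightarrow> \<bar>dot (W i) c\<bar> \<le> D"
  shows "\<exists>v\<in>K. fractional v = {} \<and> (\<forall>e. of_int \<lfloor>y e\<rfloor> \<le> v e) \<and> (\<forall>e. v e \<le> of_int \<lceil>y e\<rceil>) \<and>
    (\<forall>i<k. \<bar>dot (W i) v\<bar> \<le> real k * D)"
proof -
  define Q where "Q z \<longleftrightarrow> z \<in> K \<and> (\<forall>i<k. dot (W i) z = 0) \<and>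
    (\<forall>e. of_int \<lfloor>y e\<rfloor> \<le> z e \<and> z e \<le> of_int \<lceil>y e\<rceil>)" for z
  have "Q y"
    using y by (auto simp: Q_def)
  then obtain z where z: "Q z" and min: "\<And>z'. Q z' \<Longrightarrow> card (fractional z) \<le> card (fractional z')"
    using ex_has_least_nat[of Q y "\<lambda>z. card (fractional z)"] by blast
  have zK: "z \<in> K"
    using z by (simp add: Q_def)
  have fl: "\<lfloor>y e\<rfloor> \<le> \<lfloor>z e\<rfloor>" "\<lceil>z e\<rceil> \<le> \<lceil>y e\<rceil>" for e
    using z by (auto simp: Q_def le_floor_iff ceiling_le_iff)
  have fin: "finite (fractional z)"
    by (rule finite_subset[OF fractional_subset_nonzeros finite_nonzeros[OF zK]])
  have inj: "nonzeros x = {}" if x: "x \<in> K" "nonzeros x \<subseteq> fractional z" "\<forall>i\<in>{..<k}. dot (W i) x = 0" for x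
  proof (rule ccontr)
    assume ne: "nonzeros x \<noteq> {}"
    obtain t f where "0 \<le> t" and t: "f \<in> nonzeros x"
      "fractional (\<lambda>e. z e + t * x e) \<subseteq> fractional z - {f}"
      "\<And>e. of_int \<lfloor>z e\<rfloor> \<le> z e + t * x e" "\<And>e. z e + t * x e \<le> of_int \<lceil>z e\<rceil>"
      and "t * \<bar>x f\<bar> \<le> 1"
      using move_to_integral[OF zK x(1) ne x(2)] by blast
    have "Q (\<lambda>e. z e + t * x e)"
      unfolding Q_def
    proof (intro conjI allI impI)
      show "(\<lambda>e. z e + t * x e) \<in> K"
        using K_add_scaled zK x(1) by blast
      show "dot (W i) (\<lambda>e. z e + t * x e) = 0" if "i < k" for i
        using that x(3) z by (simp add: dot_add_scaled Q_def)
      show "of_int \<lfloor>y e\<rfloor> \<le> z e + t * x e" for e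
        using t(3)[of e] fl(1)[of e] by linarith
      show "z e + t * x e \<le> of_int \<lceil>y e\<rceil>" for e
        using t(4)[of e] fl(2)[of e] by linarith
    qed
    then have "card (fractional z) \<le> card (fractional (\<lambda>e. z e + t * x e))"
      by (rule min)
    moreover have "card (fractional (\<lambda>e. z e + t * x e)) < card (fractional z)"
      using t(1,2) x(2) fin by (intro psubset_card_mono) auto
    ultimately show False
      by simp
  qed
  have "\<exists>v\<in>K. fractional v = {} \<and> (\<forall>e. of_int \<lfloor>z e\<rfloor> \<le> v e \<and> v e \<le> of_int \<lceil>z e\<rceil>) \<and>
      (\<forall>w D. 0 \<le> D \<longrightarrow> (\<forall>c. elementary c \<longrightarrow> \<bar>dot w c\<bar> \<le> D) \<longrightarrow>
        \<bar>dot w v - dot w z\<bar> \<le> real (card {..<k}) * D)"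
    by (rule integral_rounding[where \<phi> = W, OF finite_lessThan zK]) (rule inj)
  then obtain v where v: "v \<in> K" "fractional v = {}" "\<forall>e. of_int \<lfloor>z e\<rfloor> \<le> v e \<and> v e \<le> of_int \<lceil>z e\<rceil>"
    "\<forall>w D. 0 \<le> D \<longrightarrow> (\<forall>c. elementary c \<longrightarrow> \<bar>dot w c\<bar> \<le> D) \<longrightarrow>
      \<bar>dot w v - dot w z\<bar> \<le> real (card {..<k}) * D"
    by (elim bexE conjE) (rule that)
  show ?thesis
  proof (intro bexI[OF _ v(1)] conjI allI impI)
    show "fractional v = {}"
      by (rule v(2))
    show "of_int \<lfloor>y e\<rfloor> \<le> v e" for e
      using v(3)[rule_format, of e] fl(1)[of e] by linarith
    show "v e \<le> of_int \<lceil>y e\<rceil>" for e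
      using v(3)[rule_format, of e] fl(2)[of e] by linarith
    show "\<bar>dot (W i) v\<bar> \<le> real k * D" if "i < k" for i
    proof -
      have "\<bar>dot (W i) v - dot (W i) z\<bar> \<le> real (card {..<k}) * D"
        using v(4) D that by simp
      then show ?thesis
        using z that by (simp add: Q_def)
    qed
  qed
qed

end

section \<open>Zero-sum sub-collections\<close>

text \<open>A monotone subsequence that is not increasing is decreasing, and in the natural numbers
  it is constant from its minimum on.\<close>

lemma nat_mono_subseq:
  fixes s :: "nat \<Rightarrow> nat"
  obtains r :: "nat \<Rightarrow> nat" where "strict_mono r" "mono (\<lambda>n. s (r n))"
proof -
  obtain f :: "nat \<Rightarrow> nat" where f: "strict_mono f" "monoseq (\<lambda>n. s (f n))"
    using seq_monosub[of s] by auto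
  show ?thesis
  proof (cases "\<forall>m n. m \<le> n \<longrightarrow> s (f m) \<le> s (f n)")
    case True
    then show ?thesis
      using that[of f] f(1) by (auto simp: mono_def)
  next
    case False
    then have dec: "s (f n) \<le> s (f m)" if "m \<le> n" for m n
      using f(2) that by (auto simp: monoseq_def)
    obtain n0 where n0: "\<And>n. s (f n0) \<le> s (f n)"
      using ex_has_least_nat[where P = "\<lambda>_ :: nat. True" and m = "\<lambda>n. s (f n)"] by auto
    have "s (f (n0 + n)) = s (f n0)" for n
      using n0 dec by (simp add: order_antisym)
    then show ?thesis
      using that[of "\<lambda>n. f (n0 + n)"] f(1) by (auto simp: mono_def strict_mono_def)
  qed
qed

lemma simultaneous_mono_subseq:
  fixes H :: "(nat \<Rightarrow> nat) set"
  assumes "finite H"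
  shows "\<exists>r :: nat \<Rightarrow> nat. strict_mono r \<and> (\<forall>h\<in>H. mono (\<lambda>n. h (r n)))"
  using assms
proof (induction H)
  case empty
  then show ?case
    by (intro exI[of _ "\<lambda>n. n"]) (simp add: strict_mono_def)
next
  case (insert s H)
  then obtain r :: "nat \<Rightarrow> nat" where r: "strict_mono r" "\<forall>h\<in>H. mono (\<lambda>n. h (r n))"
    by blast
  obtain q :: "nat \<Rightarrow> nat" where q: "strict_mono q" "mono (\<lambda>n. s (r (q n)))"
    using nat_mono_subseq[of "\<lambda>n. s (r n)"] by blast
  have "mono (\<lambda>n. h (r (q n)))" if "h \<in> H" for h
    using r(2) that strict_mono_mono[OF q(1)] by (auto simp: mono_def)
  then show ?case
    using q strict_mono_o[OF r(1) q(1)] by (intro exI[of _ "\<lambda>n. r (q n)"]) (auto simp: o_def)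
qed

text \<open>Dickson's lemma replaces the Steinitz rearrangement argument: among infinitely many
  multiplicity vectors, two are comparable and have the same weighted sum, and their difference
  is the required sub-collection.\<close>

lemma zero_sum_subcollection:
  fixes g :: "'b \<Rightarrow> nat \<Rightarrow> int"
  assumes T: "finite T" and J: "J \<subseteq> T"
  shows "\<exists>N. \<forall>n :: 'b \<Rightarrow> nat. N \<le> sum n J \<longrightarrow> (\<forall>i<k. \<bar>\<Sum>\<tau>\<in>T. int (n \<tau>) * g \<tau> i\<bar> \<le> R) \<longrightarrow>
    (\<exists>\<mu>. (\<forall>\<tau>\<in>T. \<mu> \<tau> \<le> n \<tau>) \<and> 0 < sum \<mu> J \<and> (\<forall>i<k. (\<Sum>\<tau>\<in>T. int (\<mu> \<tau>) * g \<tau> i) = 0))"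
proof (rule ccontr)
  define sm where "sm n i = (\<Sum>\<tau>\<in>T. int (n \<tau>) * g \<tau> i)" for n i
  assume "\<not> ?thesis"
  then have "\<forall>N. \<exists>n. N \<le> sum n J \<and> (\<forall>i<k. \<bar>sm n i\<bar> \<le> R) \<and>
      \<not> (\<exists>\<mu>. (\<forall>\<tau>\<in>T. \<mu> \<tau> \<le> n \<tau>) \<and> 0 < sum \<mu> J \<and> (\<forall>i<k. sm \<mu> i = 0))"
    unfolding sm_def by blast
  then obtain n where n: "\<And>N. N \<le> sum (n N) J" "\<And>N i. i < k \<Longrightarrow> \<bar>sm (n N) i\<bar> \<le> R"
      "\<And>N. \<not> (\<exists>\<mu>. (\<forall>\<tau>\<in>T. \<mu> \<tau> \<le> n N \<tau>) \<and> 0 < sum \<mu> J \<and> (\<forall>i<k. sm \<mu> i = 0))"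
    by metis
  \<comment> \<open>Both \<open>R + sm\<close> and \<open>R - sm\<close> are nonnegative by the
    bound on \<open>sm\<close>. Making both monotone along the subsequence forces the weighted sums
    to be equal.\<close>
  define H where "H = (\<lambda>\<tau> N. n N \<tau>) ` T \<union> (\<lambda>i N. nat (R + sm (n N) i)) ` {..<k} \<union>
    (\<lambda>i N. nat (R - sm (n N) i)) ` {..<k}"
  have "finite H"
    using T by (simp add: H_def)
  then obtain r :: "nat \<Rightarrow> nat" where r: "strict_mono r" "\<forall>h\<in>H. mono (\<lambda>N. h (r N))"
    using simultaneous_mono_subseq by blast
  define a where "a = r 0"
  \<comment> \<open>Chosen late enough that the count on \<open>J\<close> strictly exceeds that of
    \<open>n a\<close>, so the difference is positive on \<open>J\<close>.\<close>
  define b where "b = r (Suc (sum (n a) J))"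
  have le: "h a \<le> h b" if "h \<in> H" for h
    using r(2) that unfolding a_def b_def by (auto simp: mono_def)
  have n_le: "n a \<tau> \<le> n b \<tau>" if "\<tau> \<in> T" for \<tau>
    using le[of "\<lambda>N. n N \<tau>"] that by (auto simp: H_def)
  have sm_eq: "sm (n a) i = sm (n b) i" if "i < k" for i
  proof -
    have "nat (R + sm (n a) i) \<le> nat (R + sm (n b) i)" "nat (R - sm (n a) i) \<le> nat (R - sm (n b) i)"
      using le[of "\<lambda>N. nat (R + sm (n N) i)"] le[of "\<lambda>N. nat (R - sm (n N) i)"] that
      by (auto simp: H_def)
    then show ?thesis
      using n(2)[OF that, of a] n(2)[OF that, of b] by linarith
  qed
  define \<mu> where "\<mu> \<tau> = n b \<tau> - n a \<tau>" for \<tau>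
  have "sum (n a) J < b"
    using seq_suble[OF r(1), of "Suc (sum (n a) J)"] by (simp add: b_def)
  then have "sum (n a) J < sum (n b) J"
    using n(1)[of b] by linarith
  moreover have "sum \<mu> J = sum (n b) J - sum (n a) J"
    unfolding \<mu>_def using n_le J by (intro sum_subtractf_nat) blast
  ultimately have "0 < sum \<mu> J"
    by simp
  moreover have "sm \<mu> i = 0" if "i < k" for i
  proof -
    have "sm \<mu> i = sm (n b) i - sm (n a) i"
      unfolding sm_def sum_subtractf[symmetric]
      by (intro sum.cong) (auto simp: \<mu>_def of_nat_diff n_le left_diff_distrib)
    then show ?thesis
      using sm_eq[OF that] by simp
  qed
  moreover have "\<forall>\<tau>\<in>T. \<mu> \<tau> \<le> n b \<tau>"
    by (simp add: \<mu>_def)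
  ultimately show False
    using n(3)[of b] by blast
qed

lemma exists_subset_with_fibre_cards:
  assumes S: "finite S" and \<mu>: "\<And>\<tau>. \<tau> \<in> T \<Longrightarrow> \<mu> \<tau> \<le> card {x \<in> S. ty x = \<tau>}"
  obtains S' where "S' \<subseteq> S" "ty ` S' \<subseteq> T" "\<And>\<tau>. \<tau> \<in> T \<Longrightarrow> card {x \<in> S'. ty x = \<tau>} = \<mu> \<tau>"
proof -
  have "\<forall>\<tau>\<in>T. \<exists>B. B \<subseteq> {x \<in> S. ty x = \<tau>} \<and> card B = \<mu> \<tau>"
    using \<mu> obtain_subset_with_card_n by metis
  then obtain B where B: "\<And>\<tau>. \<tau> \<in> T \<Longrightarrow> B \<tau> \<subseteq> {x \<in> S. ty x = \<tau>} \<and> card (B \<tau>) = \<mu> \<tau>"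
    by metis
  define S' where "S' = (\<Union>\<tau>\<in>T. B \<tau>)"
  have fibre: "{x \<in> S'. ty x = \<tau>} = B \<tau>" if "\<tau> \<in> T" for \<tau>
    using B that unfolding S'_def by blast
  show ?thesis
  proof (rule that[of S'])
    show "S' \<subseteq> S" "ty ` S' \<subseteq> T"
      using B unfolding S'_def by blast+
    show "card {x \<in> S'. ty x = \<tau>} = \<mu> \<tau>" if "\<tau> \<in> T" for \<tau>
      using B that by (simp add: fibre)
  qed
qed

text \<open>The Boolean component of a type records whether a vector uses the distinguished coordinate.\<close>

definition value_types :: "nat \<Rightarrow> nat \<Rightarrow> ((nat \<Rightarrow> int) \<times> bool) set" where
  "value_types k \<Delta> = ({..<k} \<rightarrow>\<^sub>E {- int \<Delta>..int \<Delta>}) \<times> UNIV"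

text \<open>\<open>zero_sum_subcollection\<close> with circuits sorted by their \<open>k\<close>
  values under \<open>W\<close>. The bound \<open>k * \<Delta>\<close> is the one that rounding
  leaves on \<open>W\<close>. No matrix enters, so the final distance depends on \<open>k\<close>
  and \<open>\<Delta>\<close> alone.\<close>

definition zero_sum_threshold :: "nat \<Rightarrow> nat \<Rightarrow> nat \<Rightarrow> bool" where
  "zero_sum_threshold k \<Delta> N \<longleftrightarrow> (\<forall>n :: (nat \<Rightarrow> int) \<times> bool \<Rightarrow> nat.
    N \<le> sum n {\<tau> \<in> value_types k \<Delta>. snd \<tau>} \<longrightarrow>
    (\<forall>i<k. \<bar>\<Sum>\<tau>\<in>value_types k \<Delta>. int (n \<tau>) * fst \<tau> i\<bar> \<le> int (k * \<Delta>)) \<longrightarrow>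
    (\<exists>\<mu>. (\<forall>\<tau>\<in>value_types k \<Delta>. \<mu> \<tau> \<le> n \<tau>) \<and> 0 < sum \<mu> {\<tau> \<in> value_types k \<Delta>. snd \<tau>} \<and>
      (\<forall>i<k. (\<Sum>\<tau>\<in>value_types k \<Delta>. int (\<mu> \<tau>) * fst \<tau> i) = 0)))"

lemma finite_value_types: "finite (value_types k \<Delta>)"
  by (simp add: value_types_def finite_PiE)

lemma exists_zero_sum_threshold: "\<exists>N. zero_sum_threshold k \<Delta> N"
  unfolding zero_sum_threshold_def
  by (rule zero_sum_subcollection[OF finite_value_types]) blast

lemma sum_by_fibres:
  fixes F :: "'b \<Rightarrow> 'c::semiring_1"
  assumes "finite S" "finite T" "ty ` S \<subseteq> T"
  shows "(\<Sum>x\<in>S. F (ty x)) = (\<Sum>\<tau>\<in>T. of_nat (card {x \<in> S. ty x = \<tau>}) * F \<tau>)"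
proof -
  have "(\<Sum>x\<in>S. F (ty x)) = (\<Sum>\<tau>\<in>T. \<Sum>x\<in>{x \<in> S. ty x = \<tau>}. F (ty x))"
    by (rule sum.group[OF assms, symmetric])
  also have "\<dots> = (\<Sum>\<tau>\<in>T. of_nat (card {x \<in> S. ty x = \<tau>}) * F \<tau>)"
    by (intro sum.cong) auto
  finally show ?thesis .
qed

section \<open>Integral steps annihilated by the additional constraints\<close>

context unimodular_space
begin

lemma K_sum:
  assumes "\<And>x. x \<in> S \<Longrightarrow> c x \<in> K"
  shows "(\<lambda>e. \<Sum>x\<in>S. c x e) \<in> K"
  using assms
proof (induction S rule: infinite_finite_induct)
  case (insert x S)
  then show ?case
    using K_add_scaled[of "c x" "\<lambda>e. \<Sum>x\<in>S. c x e" 1] by simp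
qed (use zero_in_K in auto)

lemma dot_sum: "dot w (\<lambda>e. \<Sum>x\<in>S. c x e) = (\<Sum>x\<in>S. dot w (c x))"
  unfolding dot_def by (simp add: sum_distrib_left sum.swap[of _ S])

text \<open>Round \<open>y\<close> to \<open>v0\<close>, decompose \<open>v0\<close> conformally,
  and let \<open>v\<close> be the sum of a zero-sum sub-collection that uses \<open>j\<close>. All
  summands share the signs of \<open>v0\<close>, so each entry of \<open>v\<close> lies between 0
  and the entry of \<open>v0\<close>, hence between 0 and \<open>y\<close> rounded away from
  0.\<close>

lemma exists_integral_step:
  assumes thr: "zero_sum_threshold k \<Delta> N"
    and y: "y \<in> K" "\<forall>i<k. dot (W i) y = 0"
    and W: "\<forall>i<k. \<forall>e. W i e \<in> \<int>" "\<forall>i<k. \<forall>c. elementary c \<longrightarrow> \<bar>dot (W i) c\<bar> \<le> real \<Delta>"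
    and j: "real N + 1 \<le> \<bar>y j\<bar>"
  shows "\<exists>v\<in>K. fractional v = {} \<and> (\<forall>i<k. dot (W i) v = 0) \<and> v j \<noteq> 0 \<and>
    (\<forall>e. (0 \<le> y e \<longrightarrow> 0 \<le> v e \<and> v e \<le> of_int \<lceil>y e\<rceil>) \<and> (y e \<le> 0 \<longrightarrow> of_int \<lfloor>y e\<rfloor> \<le> v e \<and> v e \<le> 0))"
proof -
  define T where "T = value_types k \<Delta>"
  define J where "J = {\<tau> \<in> T. snd \<tau>}"
  have fin: "finite T" "J \<subseteq> T" "finite J"
    using finite_value_types by (auto simp: T_def J_def)
  obtain v0 where v0: "v0 \<in> K" "fractional v0 = {}"
    "\<forall>e. of_int \<lfloor>y e\<rfloor> \<le> v0 e" "\<forall>e. v0 e \<le> of_int \<lceil>y e\<rceil>"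
    "\<forall>i<k. \<bar>dot (W i) v0\<bar> \<le> real k * real \<Delta>"
    using integral_rounding_bounded[OF y of_nat_0_le_iff W(2)] by (elim bexE conjE) (rule that)
  obtain cs where cs: "\<forall>c\<in>set cs. elementary c \<and> conformal c v0" "v0 = (\<lambda>e. \<Sum>c\<leftarrow>cs. c e)"
    using integral_decomposition[OF v0(1,2)] by blast
  \<comment> \<open>Summands are indexed by their positions, so that repeated vectors are counted
    with multiplicity.\<close>
  define S where "S = {..<length cs}"
  define C where "C x = cs ! x" for x
  have C: "elementary (C x)" "conformal (C x) v0" if "x \<in> S" for x
    using cs(1) that by (auto simp: S_def C_def)
  then have CK: "C x \<in> K" if "x \<in> S" for x
    using that elementary_def by blast
  have v0_sum: "v0 = (\<lambda>e. \<Sum>x\<in>S. C x e)"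
    using cs(2) by (simp add: sum_list_sum_nth S_def C_def atLeast0LessThan)
  have dot_int: "dot (W i) (C x) = of_int \<lfloor>dot (W i) (C x)\<rfloor>" if "x \<in> S" "i < k" for x i
  proof -
    have "C x e \<in> \<int>" for e
      using elementary_values[OF C(1)[OF that(1)], of e] by auto
    then have "dot (W i) (C x) \<in> \<int>"
      unfolding dot_def using W(1) that(2) by (intro Ints_sum Ints_mult) auto
    then show ?thesis
      by (metis Ints_cases floor_of_int)
  qed
  \<comment> \<open>The value vector is restricted to \<open>{..<k}\<close> so that types lie in the
    finite set \<open>value_types\<close>; the floor only casts values that are integral
    already.\<close>
  define ty where "ty x = (\<lambda>i\<in>{..<k}. \<lfloor>dot (W i) (C x)\<rfloor>, C x j \<noteq> 0)" for x
  have ty_T: "ty ` S \<subseteq> T"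
  proof
    fix \<tau> assume "\<tau> \<in> ty ` S"
    then obtain x where x: "x \<in> S" "\<tau> = ty x"
      by blast
    have "\<lfloor>dot (W i) (C x)\<rfloor> \<in> {- int \<Delta>..int \<Delta>}" if "i < k" for i
      using W(2)[rule_format, OF that C(1)[OF x(1)]] dot_int[OF x(1) that] by (auto simp: le_floor_iff floor_le_iff)
    then show "\<tau> \<in> T"
      by (auto simp: x(2) ty_def T_def value_types_def)
  qed
  define n where "n \<tau> = card {x \<in> S. ty x = \<tau>}" for \<tau>
  have dot_types: "dot (W i) (\<lambda>e. \<Sum>x\<in>S'. C x e) =
      of_int (\<Sum>\<tau>\<in>T. int (card {x \<in> S'. ty x = \<tau>}) * fst \<tau> i)" if "S' \<subseteq> S" "i < k" for S' i
  proof -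
    have "dot (W i) (\<lambda>e. \<Sum>x\<in>S'. C x e) = of_int (\<Sum>x\<in>S'. fst (ty x) i)"
      unfolding dot_sum of_int_sum using that dot_int by (intro sum.cong) (auto simp: ty_def)
    also have "(\<Sum>x\<in>S'. fst (ty x) i) = (\<Sum>\<tau>\<in>T. int (card {x \<in> S'. ty x = \<tau>}) * fst \<tau> i)"
      using that ty_T fin finite_subset[of S' S] by (intro sum_by_fibres) (auto simp: S_def)
    finally show ?thesis .
  qed
  have card_types: "card {x \<in> S'. C x j \<noteq> 0} = (\<Sum>\<tau>\<in>J. card {x \<in> S'. ty x = \<tau>})" if "S' \<subseteq> S" for S'
  proof -
    have "finite S'"
      using that finite_subset by (auto simp: S_def)
    have "(\<Sum>\<tau>\<in>J. card {x \<in> S'. ty x = \<tau>}) = (\<Sum>\<tau>\<in>J. \<Sum>x\<in>{x \<in> {x \<in> S'. C x j \<noteq> 0}. ty x = \<tau>}. 1)"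
      by (intro sum.cong) (auto simp: J_def ty_def intro!: arg_cong[where f = card])
    also have "\<dots> = (\<Sum>x\<in>{x \<in> S'. C x j \<noteq> 0}. 1)"
      using ty_T that \<open>finite S'\<close> fin by (intro sum.group) (auto simp: J_def ty_def)
    finally show ?thesis
      by simp
  qed
  have "\<bar>\<Sum>\<tau>\<in>T. int (n \<tau>) * fst \<tau> i\<bar> \<le> int (k * \<Delta>)" if "i < k" for i
  proof -
    have "dot (W i) v0 = of_int (\<Sum>\<tau>\<in>T. int (n \<tau>) * fst \<tau> i)"
      using dot_types[OF subset_refl that] unfolding v0_sum[symmetric] n_def .
    then have "\<bar>real_of_int (\<Sum>\<tau>\<in>T. int (n \<tau>) * fst \<tau> i)\<bar> \<le> real k * real \<Delta>"
      using v0(5)[rule_format, OF that] by (simp only:)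
    then have "real_of_int \<bar>\<Sum>\<tau>\<in>T. int (n \<tau>) * fst \<tau> i\<bar> \<le> real_of_int (int (k * \<Delta>))"
      by (simp only: of_int_abs of_int_of_nat_eq of_int_mult of_nat_mult)
    then show ?thesis
      by (simp only: of_int_le_iff)
  qed
  moreover have "N \<le> sum n J"
  proof -
    \<comment> \<open>Rounding costs less than 1, which the hypothesis
      \<open>real N + 1 \<le> \<bar>y j\<bar>\<close> provides for. As each summand contributes at
      most 1 in absolute value, at least \<open>N\<close> of them use \<open>j\<close>.\<close>
    have "real N \<le> \<bar>v0 j\<bar>"
    proof (cases "0 \<le> y j")
      case True
      then show ?thesis
        using j v0(3)[rule_format, of j] by linarith
    next
      case False
      then show ?thesis
        using j v0(4)[rule_format, of j] by linarith
    qed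
    also have "\<bar>v0 j\<bar> = \<bar>\<Sum>x\<in>S. C x j\<bar>"
      by (subst v0_sum) simp
    also have "\<dots> \<le> (\<Sum>x\<in>S. \<bar>C x j\<bar>)"
      by (rule sum_abs)
    also have "\<dots> = (\<Sum>x\<in>S. if C x j \<noteq> 0 then 1 else 0)"
      using elementary_values[OF C(1), of _ j] by (intro sum.cong refl) fastforce
    also have "\<dots> = real (card {x \<in> S. C x j \<noteq> 0})"
      by (simp add: sum.If_cases S_def Int_def)
    finally have "N \<le> card {x \<in> S. C x j \<noteq> 0}"
      by (simp only: of_nat_le_iff)
    then show ?thesis
      using card_types[OF subset_refl] by (simp add: n_def)
  qed
  ultimately obtain \<mu> where \<mu>: "\<forall>\<tau>\<in>T. \<mu> \<tau> \<le> n \<tau>" "0 < sum \<mu> J"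
      "\<forall>i<k. (\<Sum>\<tau>\<in>T. int (\<mu> \<tau>) * fst \<tau> i) = 0"
    using thr unfolding zero_sum_threshold_def T_def[symmetric] J_def[symmetric] by blast
  obtain S' where S': "S' \<subseteq> S" "ty ` S' \<subseteq> T" "\<And>\<tau>. \<tau> \<in> T \<Longrightarrow> card {x \<in> S'. ty x = \<tau>} = \<mu> \<tau>"
    using exists_subset_with_fibre_cards[of S T \<mu> ty] \<mu>(1) unfolding n_def S_def by blast
  have "finite S'"
    using S'(1) finite_subset by (auto simp: S_def)
  define v where "v e = (\<Sum>x\<in>S'. C x e)" for e
  have sgn_C: "0 \<le> C x e * v0 e" "v0 e = 0 \<Longrightarrow> C x e = 0" if "x \<in> S" for x e
    using C(2)[OF that] by (auto simp: conformal_def)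
  have v_pos: "0 \<le> v e \<and> v e \<le> v0 e" if "0 \<le> v0 e" for e
  proof -
    have "0 \<le> C x e" if "x \<in> S" for x
      using sgn_C[OF that, of e] \<open>0 \<le> v0 e\<close> by (cases "v0 e = 0") (auto simp: zero_le_mult_iff)
    moreover have "v0 e = (\<Sum>x\<in>S. C x e)"
      by (subst v0_sum) simp
    ultimately show ?thesis
      using S'(1) unfolding v_def by (auto intro!: sum_nonneg sum_mono2 simp: S_def)
  qed
  have v_neg: "v0 e \<le> v e \<and> v e \<le> 0" if "v0 e \<le> 0" for e
  proof -
    have le0: "C x e \<le> 0" if "x \<in> S" for x
      using sgn_C[OF that, of e] \<open>v0 e \<le> 0\<close> by (cases "v0 e = 0") (auto simp: zero_le_mult_iff)
    have "v0 e = (\<Sum>x\<in>S. C x e)"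
      by (subst v0_sum) simp
    also have "\<dots> = (\<Sum>x\<in>S - S'. C x e) + v e"
      unfolding v_def using S'(1) by (intro sum.subset_diff) (auto simp: S_def)
    moreover have "(\<Sum>x\<in>S - S'. C x e) \<le> 0"
      using le0 by (intro sum_nonpos) auto
    moreover have "v e \<le> 0"
      unfolding v_def using le0 S'(1) by (intro sum_nonpos) auto
    ultimately show ?thesis
      by linarith
  qed
  show ?thesis
  proof (intro bexI[of _ v] conjI allI impI)
    show "v \<in> K"
      unfolding v_def[abs_def] using CK S'(1) by (intro K_sum) auto
    have "C x e \<in> \<int>" if "x \<in> S'" for x e
      using elementary_values[OF C(1)[OF subsetD[OF S'(1) that]], of e] by auto
    then show "fractional v = {}"
      by (auto simp: fractional_def v_def intro!: Ints_sum)
    show "dot (W i) v = 0" if "i < k" for i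
      using dot_types[OF S'(1) that] \<mu>(3) that S'(3) unfolding v_def[abs_def] by simp
    have "card {x \<in> S'. C x j \<noteq> 0} = sum \<mu> J"
      unfolding card_types[OF S'(1)] using S'(3) fin(2) by (intro sum.cong) auto
    then obtain x where x: "x \<in> S'" "C x j \<noteq> 0"
      using \<mu>(2) by (metis (mono_tags, lifting) Collect_empty_eq card.empty less_irrefl)
    \<comment> \<open>No cancellation at \<open>j\<close>: multiplied by \<open>v0 j\<close>, all
      terms are nonnegative, and the one from \<open>x\<close> is nonzero.\<close>
    show "v j \<noteq> 0"
    proof
      assume "v j = 0"
      have "(\<Sum>x\<in>S'. C x j * v0 j) = 0"
        using \<open>v j = 0\<close> by (simp add: v_def sum_distrib_right[symmetric])
      then have "C x j * v0 j = 0"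
        using x(1) sgn_C(1) S'(1) \<open>finite S'\<close> sum_nonneg_eq_0_iff[of S' "\<lambda>x. C x j * v0 j"] by blast
      then show False
        using x sgn_C(2)[of x j] S'(1) by auto
    qed
    fix e
    show "0 \<le> v e" "v e \<le> of_int \<lceil>y e\<rceil>" if "0 \<le> y e"
    proof -
      have "0 \<le> \<lfloor>y e\<rfloor>"
        using that by simp
      then have "0 \<le> v0 e"
        using v0(3)[rule_format, of e] by linarith
      then show "0 \<le> v e" "v e \<le> of_int \<lceil>y e\<rceil>"
        using v_pos[of e] v0(4)[rule_format, of e] by linarith+
    qed
    show "of_int \<lfloor>y e\<rfloor> \<le> v e" "v e \<le> 0" if "y e \<le> 0"
    proof -
      have "\<lceil>y e\<rceil> \<le> 0"
        using that by simp
      then have "v0 e \<le> 0"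
        using v0(4)[rule_format, of e] by linarith
      then show "of_int \<lfloor>y e\<rfloor> \<le> v e" "v e \<le> 0"
        using v_neg[of e] v0(3)[rule_format, of e] by linarith+
    qed
  qed
qed

end

section \<open>Proximity of integral optima\<close>

text \<open>Kernel vectors as functions on all naturals, extended by 0 beyond the columns so that
  supports lie in the finite index set.\<close>

definition real_kernel :: "int mat \<Rightarrow> (nat \<Rightarrow> real) set" where
  "real_kernel A = {x. (\<forall>e\<ge>dim_col A. x e = 0) \<and>
    (\<forall>i<dim_row A. (\<Sum>j<dim_col A. of_int (A $$ (i, j)) * x j) = 0)}"

lemma unimodular_space_real_kernel:
  assumes "totally_unimodular A"
  shows "unimodular_space {..<dim_col A} (real_kernel A)"
proof
  show "(\<lambda>e. x e + t * y e) \<in> real_kernel A" if "x \<in> real_kernel A" "y \<in> real_kernel A" for x y t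
  proof -
    have "(\<Sum>j<dim_col A. of_int (A $$ (i, j)) * (x j + t * y j)) =
        (\<Sum>j<dim_col A. of_int (A $$ (i, j)) * x j) + t * (\<Sum>j<dim_col A. of_int (A $$ (i, j)) * y j)" for i
      by (simp add: distrib_left sum.distrib sum_distrib_left mult.left_commute)
    then show ?thesis
      using that by (simp add: real_kernel_def)
  qed
  show "nonzeros x \<subseteq> {..<dim_col A}" if "x \<in> real_kernel A" for x
    using that by (auto simp: real_kernel_def nonzeros_def not_le[symmetric])
  show "\<exists>v\<in>real_kernel A. nonzeros v \<noteq> {} \<and> nonzeros v \<subseteq> fractional z"
    if z: "z \<in> real_kernel A" and frac: "fractional z \<noteq> {}" for z
  proof -
    obtain j0 where j0: "z j0 \<notin> \<int>"
      using frac by (auto simp: fractional_def)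
    have "j0 < dim_col A"
    proof (rule ccontr)
      assume "\<not> j0 < dim_col A"
      then have "z j0 = 0"
        using z by (simp add: real_kernel_def)
      then show False
        using j0 by simp
    qed
    have z0: "(\<Sum>j<dim_col A. of_int (A $$ (i, j)) * z j) = 0" if "i < dim_row A" for i
      using z that by (simp add: real_kernel_def)
    show ?thesis
    proof (rule totally_unimodular_fractional_kernel[OF assms z0 \<open>j0 < dim_col A\<close> j0])
      fix v :: "nat \<Rightarrow> real" and f
      assume v: "v f \<noteq> 0" "\<And>j. v j \<noteq> 0 \<Longrightarrow> j < dim_col A \<and> z j \<notin> \<int>"
        "\<And>i. i < dim_row A \<Longrightarrow> (\<Sum>j<dim_col A. of_int (A $$ (i, j)) * v j) = 0"
      have "v \<in> real_kernel A"
        using v(2,3) by (auto simp: real_kernel_def not_le[symmetric])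
      moreover have "nonzeros v \<noteq> {}" "nonzeros v \<subseteq> fractional z"
        using v(1,2) by (auto simp: nonzeros_def fractional_def)
      ultimately show ?thesis
        by blast
    qed
  qed
qed (simp_all add: real_kernel_def)

lemma vec_mem_mat_kernel:
  "y \<in> mat_kernel (map_mat real_of_int A) \<longleftrightarrow> dim_vec y = dim_col A \<and>
    (\<forall>i<dim_row A. (\<Sum>j<dim_col A. of_int (A $$ (i, j)) * y $ j) = 0)"
proof -
  have "(map_mat real_of_int A *\<^sub>v y) $ i = (\<Sum>j<dim_col A. of_int (A $$ (i, j)) * y $ j)"
    if "i < dim_row A" "dim_vec y = dim_col A" for i
    using that by (simp add: scalar_prod_def atLeast0LessThan)
  then show ?thesis
    unfolding mat_kernel_def carrier_vec_def by (auto simp: vec_eq_iff)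
qed

text \<open>Makes the hypothesis on circuits available for elementary vectors. The floor merely
  casts entries in -1, 0, 1, and a nonzero entry is a unit, so the gcd is 1. Support-minimality
  carries over because vectors of \<open>mat_kernel\<close> extend by 0 to
  \<open>real_kernel A\<close>.\<close>

lemma elementary_circuit:
  assumes tu: "totally_unimodular A"
    and c: "unimodular_space.elementary (real_kernel A) c"
  shows "circuit (map_mat rat_of_int A) (vec (dim_col A) (\<lambda>e. \<lfloor>c e\<rfloor>))"
proof -
  interpret unimodular_space "{..<dim_col A}" "real_kernel A"
    by (rule unimodular_space_real_kernel[OF tu])
  let ?n = "dim_col A"
  let ?x = "vec ?n (\<lambda>e. \<lfloor>c e\<rfloor>)"
  have A_real: "map_mat real_of_rat (map_mat rat_of_int A) = map_mat real_of_int A"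
    by (rule eq_matI) auto
  have cK: "c \<in> real_kernel A"
    using c by (simp add: elementary_def)
  have c_int: "of_int \<lfloor>c e\<rfloor> = c e" for e
    using elementary_values[OF c, of e] by (elim disjE) (simp_all del: of_int_floor_cancel)
  obtain f where f: "f \<in> nonzeros c"
    using c by (auto simp: elementary_def)
  have f_less: "f < ?n"
    using f nonzeros_E[OF cK] by blast
  have supp: "vec_support ?x = nonzeros c"
  proof -
    have "\<lfloor>c e\<rfloor> \<noteq> 0 \<longleftrightarrow> c e \<noteq> 0" for e
      using c_int[of e] by (metis of_int_eq_0_iff)
    then show ?thesis
      using nonzeros_E[OF cK] by (auto simp: vec_support_def nonzeros_def)
  qed
  have "map_vec real_of_int ?x \<in> mat_kernel (map_mat real_of_int A)"
    unfolding vec_mem_mat_kernel using cK by (simp add: c_int real_kernel_def)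
  moreover have "?x \<noteq> 0\<^sub>v ?n"
  proof
    assume "?x = 0\<^sub>v ?n"
    then have "vec_support ?x = {}"
      by (simp add: vec_support_def)
    then show False
      using supp f by simp
  qed
  moreover have "Gcd {?x $ i | i. i < dim_vec ?x} = 1"
  proof (rule Gcd_eq_1_I)
    show "is_unit \<lfloor>c f\<rfloor>"
    proof -
      have "\<bar>real_of_int \<lfloor>c f\<rfloor>\<bar> = 1"
        unfolding c_int using elementary_values[OF c, of f] f by (auto simp: nonzeros_def)
      then show ?thesis
        by (simp flip: of_int_abs)
    qed
    show "\<lfloor>c f\<rfloor> \<in> {?x $ i | i. i < dim_vec ?x}"
      using f_less by (auto intro!: exI[of _ f])
  qed
  moreover have "\<not> (\<exists>y\<in>mat_kernel (map_mat real_of_int A). y \<noteq> 0\<^sub>v ?n \<and> vec_support y \<subset> vec_support ?x)"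
  proof
    assume "\<exists>y\<in>mat_kernel (map_mat real_of_int A). y \<noteq> 0\<^sub>v ?n \<and> vec_support y \<subset> vec_support ?x"
    then obtain y where y: "y \<in> mat_kernel (map_mat real_of_int A)" "y \<noteq> 0\<^sub>v ?n"
        "vec_support y \<subset> vec_support ?x"
      by blast
    define y' where "y' e = (if e < ?n then y $ e else 0)" for e
    have dim: "dim_vec y = ?n"
      using y(1) by (simp add: vec_mem_mat_kernel)
    have "y' \<in> real_kernel A"
      using y(1) by (simp add: real_kernel_def y'_def vec_mem_mat_kernel)
    moreover have supp': "nonzeros y' = vec_support y"
      using dim by (auto simp: nonzeros_def y'_def vec_support_def)
    ultimately have "nonzeros y' = {}"
      using c y(3) supp unfolding elementary_def by blast
    then have "y = 0\<^sub>v ?n"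
      using dim by (auto simp: nonzeros_def y'_def vec_eq_iff split: if_splits)
    then show False
      using y(2) by contradiction
  qed
  ultimately show ?thesis
    unfolding circuit_def Let_def A_real by simp
qed

section \<open>Coordinate forms of norm and feasibility, and existence of integral optima\<close>

lemma linf_norm_le_iff:
  assumes "0 \<le> r"
  shows "linf_norm x \<le> r \<longleftrightarrow> (\<forall>i<dim_vec x. \<bar>x $ i\<bar> \<le> r)"
proof -
  have "{\<bar>x $ i\<bar> | i. i < dim_vec x} = (\<lambda>i. \<bar>x $ i\<bar>) ` {..<dim_vec x}"
    by auto
  then show ?thesis
    using assms by (auto simp: linf_norm_def)
qed

lemma feasible_set_iff:
  fixes A :: "'a::linordered_idom mat"
  assumes "A \<in> carrier_mat m n" "b \<in> carrier_vec m" "W \<in> carrier_mat k n" "d \<in> carrier_vec k"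
    "l \<in> carrier_vec n" "u \<in> carrier_vec n"
  shows "x \<in> feasible_set A b W d l u \<longleftrightarrow> x \<in> carrier_vec n \<and>
    (\<forall>i<m. (\<Sum>j<n. A $$ (i, j) * x $ j) = b $ i) \<and> (\<forall>i<k. (\<Sum>j<n. W $$ (i, j) * x $ j) = d $ i) \<and>
    (\<forall>e<n. l $ e \<le> x $ e \<and> x $ e \<le> u $ e)"
proof (cases "x \<in> carrier_vec n")
  case True
  have "B *\<^sub>v x = c \<longleftrightarrow> (\<forall>i<r. (\<Sum>j<n. B $$ (i, j) * x $ j) = c $ i)"
    if "B \<in> carrier_mat r n" "c \<in> carrier_vec r" for B c r
    using that True by (auto simp: vec_eq_iff scalar_prod_def atLeast0LessThan)
  then show ?thesis
    using assms True by (auto simp: feasible_set_def less_eq_vec_def)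
next
  case False
  then show ?thesis
    using assms by (simp add: feasible_set_def)
qed

lemma feasible_set_real_iff:
  assumes "A \<in> carrier_mat m n" "b \<in> carrier_vec m" "W \<in> carrier_mat k n" "d \<in> carrier_vec k"
    "l \<in> carrier_vec n" "u \<in> carrier_vec n"
  shows "x \<in> feasible_set (map_mat real_of_int A) (map_vec real_of_int b) (map_mat real_of_int W)
      (map_vec real_of_int d) (map_vec real_of_int l) (map_vec real_of_int u) \<longleftrightarrow> x \<in> carrier_vec n \<and>
    (\<forall>i<m. (\<Sum>j<n. of_int (A $$ (i, j)) * x $ j) = of_int (b $ i)) \<and>
    (\<forall>i<k. (\<Sum>j<n. of_int (W $$ (i, j)) * x $ j) = of_int (d $ i)) \<and>
    (\<forall>e<n. of_int (l $ e) \<le> x $ e \<and> x $ e \<le> of_int (u $ e))"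
  using assms by (subst feasible_set_iff[of _ m n _ _ k]) (auto simp: index_map_mat)

lemma finite_int_box:
  fixes l u :: "int vec"
  assumes "u \<in> carrier_vec n"
  shows "finite {x. l \<le> x \<and> x \<le> u}"
proof (rule finite_subset)
  show "{x. l \<le> x \<and> x \<le> u} \<subseteq> vec n ` (\<Pi>\<^sub>E i\<in>{..<n}. {l $ i..u $ i})"
  proof
    fix x assume "x \<in> {x. l \<le> x \<and> x \<le> u}"
    then have "x = vec n (\<lambda>i\<in>{..<n}. x $ i)" "(\<lambda>i\<in>{..<n}. x $ i) \<in> (\<Pi>\<^sub>E i\<in>{..<n}. {l $ i..u $ i})"
      using assms by (auto simp: less_eq_vec_def vec_eq_iff)
    then show "x \<in> vec n ` (\<Pi>\<^sub>E i\<in>{..<n}. {l $ i..u $ i})"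
      by blast
  qed
qed (simp add: finite_PiE)

lemma exists_optimal_solution:
  assumes "finite F" "F \<noteq> {}"
  shows "\<exists>z. optimal_solution p F z"
proof -
  have "Max ((\<lambda>y. p \<bullet> y) ` F) \<in> (\<lambda>y. p \<bullet> y) ` F"
    using assms by (intro Max_in) auto
  then obtain z where "z \<in> F" "p \<bullet> z = Max ((\<lambda>y. p \<bullet> y) ` F)"
    by auto
  then show ?thesis
    using assms(1) by (auto simp: optimal_solution_def is_arg_max_def not_less intro!: exI[of _ z])
qed

section \<open>The exchange argument for a closest integral optimum\<close>

lemma integral_proximity:
  fixes A W :: "int mat" and p b d l u :: "int vec" and x :: "real vec"
  defines "F \<equiv> feasible_set A b W d l u"
  defines "FR \<equiv> feasible_set (map_mat real_of_int A) (map_vec real_of_int b) (map_mat real_of_int W)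
    (map_vec real_of_int d) (map_vec real_of_int l) (map_vec real_of_int u)"
  assumes thr: "zero_sum_threshold k \<Delta> N"
    and p: "p \<in> carrier_vec n" and l: "l \<in> carrier_vec n" and u: "u \<in> carrier_vec n"
    and A: "A \<in> carrier_mat m n" and tu: "totally_unimodular A" and b: "b \<in> carrier_vec m"
    and W: "W \<in> carrier_mat k n" and d: "d \<in> carrier_vec k"
    and circ: "\<And>c. circuit (map_mat rat_of_int A) c \<Longrightarrow> linf_norm (W *\<^sub>v c) \<le> int \<Delta>"
    and x: "optimal_solution (map_vec real_of_int p) FR x"
    and ne: "F \<noteq> {}"
  obtains z where "optimal_solution p F z" "linf_norm (x - map_vec real_of_int z) \<le> real N + 1"
proof -
  have dim_A: "dim_row A = m" "dim_col A = n"
    using A by auto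
  interpret unimodular_space "{..<n}" "real_kernel A"
    using unimodular_space_real_kernel[OF tu] dim_A by simp
  note F_iff = feasible_set_iff[OF A b W d l u, folded F_def]
  note FR_iff = feasible_set_real_iff[OF A b W d l u, folded FR_def]
  define Wf where "Wf i e = real_of_int (W $$ (i, e))" for i e
  have W_bound: "\<bar>dot (Wf i) c\<bar> \<le> real \<Delta>" if c: "elementary c" and i: "i < k" for c i
  proof -
    let ?c = "vec n (\<lambda>e. \<lfloor>c e\<rfloor>)"
    have c_int: "of_int \<lfloor>c e\<rfloor> = c e" for e
      using elementary_values[OF c, of e] by (elim disjE) (simp_all del: of_int_floor_cancel)
    have "linf_norm (W *\<^sub>v ?c) \<le> int \<Delta>"
      using circ elementary_circuit[OF tu c] dim_A by simp
    then have "\<bar>(W *\<^sub>v ?c) $ i\<bar> \<le> int \<Delta>"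
      using i W by (subst (asm) linf_norm_le_iff) auto
    moreover have "real_of_int ((W *\<^sub>v ?c) $ i) = dot (Wf i) c"
      using i W by (simp add: dot_def scalar_prod_def atLeast0LessThan Wf_def c_int)
    ultimately show ?thesis
      by linarith
  qed
  have x_FR: "x \<in> FR" and x_max: "\<And>y. y \<in> FR \<Longrightarrow> map_vec real_of_int p \<bullet> y \<le> map_vec real_of_int p \<bullet> x"
    using x by (auto simp: optimal_solution_def is_arg_max_def not_less)
  have x_dim: "x \<in> carrier_vec n"
    using x_FR by (simp add: FR_iff)
  have "finite F"
    by (rule finite_subset[OF _ finite_int_box[OF u, of l]]) (auto simp: F_def feasible_set_def)
  then obtain z1 where "optimal_solution p F z1"
    using exists_optimal_solution ne by blast
  define gap where "gap z = (\<Sum>e<n. nat \<lfloor>\<bar>x $ e - of_int (z $ e)\<bar>\<rfloor>)" for z :: "int vec"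
  obtain z where z: "optimal_solution p F z"
    and z_min: "\<And>z'. optimal_solution p F z' \<Longrightarrow> gap z \<le> gap z'"
    using ex_has_least_nat[of "optimal_solution p F", OF \<open>optimal_solution p F z1\<close>, of gap] by blast
  have z_F: "z \<in> F" and z_max: "\<And>y. y \<in> F \<Longrightarrow> p \<bullet> y \<le> p \<bullet> z"
    using z by (auto simp: optimal_solution_def is_arg_max_def not_less)
  have z_dim: "z \<in> carrier_vec n"
    using z_F by (simp add: F_iff)
  have z_bounds: "l $ e \<le> z $ e" "z $ e \<le> u $ e" if "e < n" for e
    using z_F that by (simp_all add: F_iff)
  have x_bounds: "of_int (l $ e) \<le> x $ e" "x $ e \<le> of_int (u $ e)" if "e < n" for e
    using x_FR that by (simp_all add: FR_iff)
  have z_eq: "(\<Sum>j<n. of_int (A $$ (i, j)) * real_of_int (z $ j)) = of_int (b $ i)" if "i < m" for i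
  proof -
    have "real_of_int (\<Sum>j<n. A $$ (i, j) * z $ j) = of_int (b $ i)"
      using z_F that by (simp only: F_iff)
    then show ?thesis
      by simp
  qed
  have z_eq': "(\<Sum>j<n. Wf i j * real_of_int (z $ j)) = of_int (d $ i)" if "i < k" for i
  proof -
    have "real_of_int (\<Sum>j<n. W $$ (i, j) * z $ j) = of_int (d $ i)"
      using z_F that by (simp only: F_iff)
    then show ?thesis
      by (simp add: Wf_def)
  qed
  define y where "y e = (if e < n then x $ e - of_int (z $ e) else 0)" for e
  have sum_y: "(\<Sum>j<n. g j * y j) = (\<Sum>j<n. g j * x $ j) - (\<Sum>j<n. g j * real_of_int (z $ j))" for g
    by (simp add: y_def right_diff_distrib sum_subtractf)
  have yK: "y \<in> real_kernel A"
    using x_FR z_eq dim_A by (simp add: real_kernel_def sum_y FR_iff) (simp add: y_def)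
  have Wy: "\<forall>i<k. dot (Wf i) y = 0"
    using x_FR z_eq' by (simp add: dot_def sum_y FR_iff) (simp add: Wf_def)
  \<comment> \<open>The 1 added to \<open>N\<close> pays for the rounding of \<open>y\<close>, and
    it also guarantees that the integer part of a large \<open>\<bar>y j\<bar>\<close> is positive
    and can decrease.\<close>
  show ?thesis
  proof (cases "\<forall>e<n. \<bar>y e\<bar> \<le> real N + 1")
    case True
    then have "linf_norm (x - map_vec real_of_int z) \<le> real N + 1"
      using x_dim z_dim by (subst linf_norm_le_iff) (auto simp: y_def)
    then show ?thesis
      using that z by blast
  next
    case False
    then obtain j where j: "j < n" "real N + 1 \<le> \<bar>y j\<bar>"
      by force
    have "\<forall>i<k. \<forall>e. Wf i e \<in> \<int>" "\<forall>i<k. \<forall>c. elementary c \<longrightarrow> \<bar>dot (Wf i) c\<bar> \<le> real \<Delta>"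
      using W_bound by (auto simp: Wf_def)
    from exists_integral_step[OF thr yK Wy this j(2)]
    obtain v where v: "v \<in> real_kernel A" "fractional v = {}" "\<forall>i<k. dot (Wf i) v = 0" "v j \<noteq> 0"
      and v_bounds: "\<forall>e. (0 \<le> y e \<longrightarrow> 0 \<le> v e \<and> v e \<le> of_int \<lceil>y e\<rceil>) \<and>
        (y e \<le> 0 \<longrightarrow> of_int \<lfloor>y e\<rfloor> \<le> v e \<and> v e \<le> 0)"
      by (elim bexE conjE) (rule that)
    have v_pos: "0 \<le> v e" "v e \<le> of_int \<lceil>y e\<rceil>" if "0 \<le> y e" for e
      using v_bounds that by blast+
    have v_neg: "of_int \<lfloor>y e\<rfloor> \<le> v e" "v e \<le> 0" if "y e \<le> 0" for e
      using v_bounds that by blast+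
    have v_int: "of_int \<lfloor>v e\<rfloor> = v e" for e
      using v(2) by (auto simp: fractional_def elim: Ints_cases)
    have vA: "(\<Sum>j<n. of_int (A $$ (i, j)) * v j) = 0" if "i < m" for i
      using v(1) that dim_A by (simp add: real_kernel_def)
    have vW: "(\<Sum>j<n. Wf i j * v j) = 0" if "i < k" for i
      using v(3) that by (simp add: dot_def)
    define pv where "pv = (\<Sum>e<n. of_int (p $ e) * v e)"
    have pv: "0 \<le> pv"
    proof -
      \<comment> \<open>A step length for which \<open>\<epsilon> * v\<close> does not exceed
        \<open>y\<close> in any entry. It is positive since \<open>y e = 0\<close> forces
        \<open>v e = 0\<close>.\<close>
      define \<epsilon> where "\<epsilon> = Min (insert 1 ((\<lambda>e. \<bar>y e\<bar> / \<bar>v e\<bar>) ` {e \<in> {..<n}. v e \<noteq> 0}))"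
      have y_nz: "y e \<noteq> 0" if "v e \<noteq> 0" for e
        using that v_pos[of e] v_neg[of e] by fastforce
      then have \<epsilon>: "0 < \<epsilon>"
        unfolding \<epsilon>_def by (subst Min_gr_iff) auto
      have \<epsilon>_le: "\<epsilon> * \<bar>v e\<bar> \<le> \<bar>y e\<bar>" if "e < n" for e
      proof (cases "v e = 0")
        case False
        then have "\<epsilon> \<le> \<bar>y e\<bar> / \<bar>v e\<bar>"
          unfolding \<epsilon>_def using that by (intro Min_le) auto
        then show ?thesis
          using False by (simp add: field_simps)
      qed simp
      \<comment> \<open>Every entry of \<open>x'\<close> lies between those of \<open>z\<close> and
        \<open>x\<close>, so \<open>x'\<close> satisfies the bounds, and optimality of
        \<open>x\<close> gives the sign of \<open>pv\<close>.\<close>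
      define x' where "x' = vec n (\<lambda>e. x $ e - \<epsilon> * v e)"
      have sum_x': "(\<Sum>j<n. g j * x' $ j) = (\<Sum>j<n. g j * x $ j) - \<epsilon> * (\<Sum>j<n. g j * v j)" for g
        by (simp add: x'_def right_diff_distrib sum_subtractf sum_distrib_left mult.left_commute)
      have "x' \<in> FR"
        unfolding FR_iff
      proof (intro conjI allI impI)
        show "x' \<in> carrier_vec n"
          by (simp add: x'_def)
        show "(\<Sum>j<n. of_int (A $$ (i, j)) * x' $ j) = of_int (b $ i)" if "i < m" for i
          using x_FR that vA by (simp add: sum_x' FR_iff)
        show "(\<Sum>j<n. of_int (W $$ (i, j)) * x' $ j) = of_int (d $ i)" if "i < k" for i
          using x_FR that vW by (simp add: sum_x' FR_iff Wf_def)
        fix e assume e: "e < n"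
        have "of_int (l $ e) \<le> x $ e - \<epsilon> * v e \<and> x $ e - \<epsilon> * v e \<le> of_int (u $ e)"
        proof (cases "0 \<le> y e")
          case True
          then have "0 \<le> \<epsilon> * v e" "\<epsilon> * v e \<le> y e"
            using \<epsilon> \<epsilon>_le[OF e] v_pos[of e] by auto
          then show ?thesis
            using e x_bounds[OF e] z_bounds[OF e] by (auto simp: y_def)
        next
          case False
          then have "\<epsilon> * v e \<le> 0" "y e \<le> \<epsilon> * v e"
            using \<epsilon> \<epsilon>_le[OF e] v_neg[of e] by (auto simp: mult_nonneg_nonpos)
          then show ?thesis
            using e x_bounds[OF e] z_bounds[OF e] by (auto simp: y_def)
        qed
        then show "of_int (l $ e) \<le> x' $ e" "x' $ e \<le> of_int (u $ e)"
          using e by (simp_all add: x'_def)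
      qed
      then have "map_vec real_of_int p \<bullet> x' \<le> map_vec real_of_int p \<bullet> x"
        by (rule x_max)
      moreover have "map_vec real_of_int p \<bullet> w = (\<Sum>e<n. of_int (p $ e) * w $ e)" if "w \<in> carrier_vec n" for w
        using p that by (simp add: scalar_prod_def atLeast0LessThan)
      moreover have "x' \<in> carrier_vec n"
        by (simp add: x'_def)
      ultimately have "0 \<le> \<epsilon> * pv"
        using x_dim sum_x'[of "\<lambda>e. of_int (p $ e)"] by (simp add: pv_def)
      then show ?thesis
        using \<epsilon> by (simp add: zero_le_mult_iff)
    qed
    \<comment> \<open>A fractional entry of \<open>y\<close> may be overshot by less than 1; this is harmless since \<open>l\<close>, \<open>u\<close>
      and \<open>z\<close> are integral and \<open>gap\<close> only counts integer parts.\<close>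
    define z' where "z' = vec n (\<lambda>e. z $ e + \<lfloor>v e\<rfloor>)"
    have sum_z': "real_of_int (\<Sum>j<n. g j * z' $ j) =
        real_of_int (\<Sum>j<n. g j * z $ j) + (\<Sum>j<n. of_int (g j) * v j)" for g
      by (simp add: z'_def distrib_left sum.distrib v_int del: of_int_floor_cancel)
    have "z' \<in> F"
      unfolding F_iff
    proof (intro conjI allI impI)
      show "z' \<in> carrier_vec n"
        by (simp add: z'_def)
      show "(\<Sum>j<n. A $$ (i, j) * z' $ j) = b $ i" if "i < m" for i
      proof -
        have "real_of_int (\<Sum>j<n. A $$ (i, j) * z' $ j) = real_of_int (\<Sum>j<n. A $$ (i, j) * z $ j)"
          unfolding sum_z' vA[OF that] by simp
        then show ?thesis
          using z_F that by (simp only: of_int_eq_iff F_iff)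
      qed
      show "(\<Sum>j<n. W $$ (i, j) * z' $ j) = d $ i" if "i < k" for i
      proof -
        have "real_of_int (\<Sum>j<n. W $$ (i, j) * z' $ j) = real_of_int (\<Sum>j<n. W $$ (i, j) * z $ j)"
          unfolding sum_z' vW[OF that, unfolded Wf_def] by simp
        then show ?thesis
          using z_F that by (simp only: of_int_eq_iff F_iff)
      qed
      fix e assume e: "e < n"
      have "l $ e \<le> z $ e + \<lfloor>v e\<rfloor> \<and> z $ e + \<lfloor>v e\<rfloor> \<le> u $ e"
      proof (cases "0 \<le> y e")
        case True
        have "\<lceil>y e\<rceil> \<le> u $ e - z $ e"
          using e x_bounds[OF e] by (simp add: y_def ceiling_le_iff)
        then show ?thesis
          using v_pos[OF True] v_int[of e] z_bounds[OF e] by linarith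
      next
        case False
        have "l $ e - z $ e \<le> \<lfloor>y e\<rfloor>"
          using e x_bounds[OF e] by (simp add: y_def le_floor_iff)
        then show ?thesis
          using v_neg[of e] False v_int[of e] z_bounds[OF e] by linarith
      qed
      then show "l $ e \<le> z' $ e" "z' $ e \<le> u $ e"
        using e by (simp_all add: z'_def)
    qed
    have "real_of_int (p \<bullet> z') = real_of_int (p \<bullet> z) + pv"
      using sum_z'[of "\<lambda>e. p $ e"] p z_dim by (simp add: scalar_prod_def atLeast0LessThan pv_def z'_def)
    then have "p \<bullet> z \<le> p \<bullet> z'"
      using pv by linarith
    then have "optimal_solution p F z'"
      using \<open>z' \<in> F\<close> z_max by (fastforce simp: optimal_solution_def is_arg_max_def not_less)
    then have "gap z \<le> gap z'"
      by (rule z_min)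
    moreover have "gap z' < gap z"
    proof -
      have z'_diff: "x $ e - of_int (z' $ e) = y e - v e" if "e < n" for e
        using that v_int[of e] by (simp add: z'_def y_def)
      have le: "nat \<lfloor>\<bar>y e - v e\<bar>\<rfloor> \<le> nat \<lfloor>\<bar>y e\<bar>\<rfloor>" for e
        using v_pos[of e] v_neg[of e] by linarith
      have "1 \<le> \<bar>v j\<bar>"
        using v(4) v_int[of j] by (metis Ints_nonzero_abs_ge1 Ints_of_int)
      \<comment> \<open>Either \<open>v j\<close> stays within \<open>y j\<close> and a full unit is
        gained, or it overshoots by less than 1. Both lower the integer part, which was at least
        1.\<close>
      have decrease: "\<bar>y j - v j\<bar> \<le> \<bar>y j\<bar> - 1 \<or> \<bar>y j - v j\<bar> < 1"
      proof (cases "0 \<le> y j")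
        case True
        then show ?thesis
          using \<open>1 \<le> \<bar>v j\<bar>\<close> v_pos[OF True] ceiling_correct[of "y j"] by linarith
      next
        case False
        then show ?thesis
          using \<open>1 \<le> \<bar>v j\<bar>\<close> v_neg[of j] floor_correct[of "y j"] by linarith
      qed
      have "1 \<le> \<lfloor>\<bar>y j\<bar>\<rfloor>"
        using j(2) by (subst le_floor_iff) simp
      moreover from this decrease have "\<lfloor>\<bar>y j - v j\<bar>\<rfloor> < \<lfloor>\<bar>y j\<bar>\<rfloor>"
        by linarith
      ultimately have less: "nat \<lfloor>\<bar>y j - v j\<bar>\<rfloor> < nat \<lfloor>\<bar>y j\<bar>\<rfloor>"
        by linarith
      have "gap z' = (\<Sum>e<n. nat \<lfloor>\<bar>y e - v e\<bar>\<rfloor>)"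
        unfolding gap_def using z'_diff by (intro sum.cong) auto
      also have "\<dots> < (\<Sum>e<n. nat \<lfloor>\<bar>y e\<bar>\<rfloor>)"
        using le less j(1) by (intro sum_strict_mono_ex1) auto
      also have "\<dots> = gap z"
        unfolding gap_def by (intro sum.cong) (auto simp: y_def)
      finally show ?thesis .
    qed
    ultimately show ?thesis
      by simp
  qed
qed

theorem theorem2p3:
  shows "\<exists>f :: nat \<Rightarrow> nat \<Rightarrow> real. \<forall>k \<Delta>. k \<ge> 1 \<longrightarrow> \<Delta> \<ge> 1 \<longrightarrow>
    (\<forall>(m :: nat) (n :: nat) (p :: int vec) (l :: int vec) (u :: int vec)
       (A :: int mat) (b :: int vec) (W :: int mat) (d :: int vec) (x_opt :: real vec).
      p \<in> carrier_vec n \<longrightarrow> l \<in> carrier_vec n \<longrightarrow> u \<in> carrier_vec n \<longrightarrow>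
      A \<in> carrier_mat m n \<longrightarrow> totally_unimodular A \<longrightarrow> b \<in> carrier_vec m \<longrightarrow>
      W \<in> carrier_mat k n \<longrightarrow> d \<in> carrier_vec k \<longrightarrow>
      (\<forall>x. circuit (map_mat rat_of_int A) x \<longrightarrow> linf_norm (W *\<^sub>v x) \<le> int \<Delta>) \<longrightarrow>
      optimal_solution (map_vec real_of_int p)
        (feasible_set (map_mat real_of_int A) (map_vec real_of_int b)
           (map_mat real_of_int W) (map_vec real_of_int d)
           (map_vec real_of_int l) (map_vec real_of_int u)) x_opt \<longrightarrow>
      feasible_set A b W d l u \<noteq> {} \<longrightarrow>
      (\<exists>z_opt. optimal_solution p (feasible_set A b W d l u) z_opt \<and>
         linf_norm (x_opt - map_vec real_of_int z_opt) \<le> f k \<Delta>))"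
proof -
  \<comment> \<open>The thresholds are chosen before any program data is fixed, which makes
    \<open>real (N k \<Delta>) + 1\<close> a legitimate choice of \<open>f\<close>.\<close>
  obtain N where N: "\<And>k \<Delta>. zero_sum_threshold k \<Delta> (N k \<Delta>)"
    using exists_zero_sum_threshold by metis
  show ?thesis
  proof (intro exI[of _ "\<lambda>k \<Delta>. real (N k \<Delta>) + 1"] allI impI)
    fix k \<Delta> m n :: nat and p l u b d :: "int vec" and A W :: "int mat" and x_opt :: "real vec"
    assume data: "p \<in> carrier_vec n" "l \<in> carrier_vec n" "u \<in> carrier_vec n" "A \<in> carrier_mat m n"
      "totally_unimodular A" "b \<in> carrier_vec m" "W \<in> carrier_mat k n" "d \<in> carrier_vec k"
      and circ: "\<forall>x. circuit (map_mat rat_of_int A) x \<longrightarrow> linf_norm (W *\<^sub>v x) \<le> int \<Delta>"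
      and opt: "optimal_solution (map_vec real_of_int p)
        (feasible_set (map_mat real_of_int A) (map_vec real_of_int b)
           (map_mat real_of_int W) (map_vec real_of_int d)
           (map_vec real_of_int l) (map_vec real_of_int u)) x_opt"
      and feasible: "feasible_set A b W d l u \<noteq> {}"
    show "\<exists>z_opt. optimal_solution p (feasible_set A b W d l u) z_opt \<and>
        linf_norm (x_opt - map_vec real_of_int z_opt) \<le> real (N k \<Delta>) + 1"
      by (rule integral_proximity[OF N data circ[rule_format] opt feasible]) blast+
  qed
qed

end
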